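(* Let $n\ge 2$ and let $\mathbf a=(a_1,\dots,a_n)$ be a vector of nonnegative integers. Then \[\rho(K_n,K'_{\mathbf a})=1+\|\mathbf a\|_1 .\]
   Context: For a nonnegative integer vector $\mathbf a=(a_1,\dots,a_n)$, $\|\mathbf a\|_1=\sum_i a_i$, and $K'_{\mathbf a}=K'_{a_1,\dots,a_n}$ is the $n$-partite graph consisting of a central clique $C$ on vertices $v_1,\dots,v_n$ together with, for each $i$, $a_i$ further vertices outside $C$, each of whose neighborhood is exactly $C\setminus\{v_i\}$. $K_n$ is the complete graph on $n$ vertices. A graphon is a symmetric measurable function $W:[0,1]^2\to[0,1]$. For a finite simple graph $G$ with vertices $v_1,\dots,v_n$, put $t(G,W)=\int_{[0,1]^n}\prod_{v_iv_j\in E(G)}W(x_i,x_j)\,dx_1\cdots dx_n$; for a finite graph $W$ (loops allowed), $t(G,W)=\hom(G,W)/|V(W)|^{|V(G)|}$, where $\hom(G,W)$ is the number of maps $V(G)\to V(W)$ sending edges to edges. For finite simple graphs $G,H$, the density domination exponent is $\rho(G,H)=\sup_W \frac{\log t(H,W)}{\log t(G,W)}\in[0,\infty]$, where $W$ ranges over all graphons (equivalently, all finite graphs) with $t(G,W)\ne 0$. Conventions: those $W$ with $t(G,W)=1$, where the quotient is undefined, are omitted; $\log 0=-\infty$, so the quotient is $+\infty$ if $t(H,W)=0$. Thus, when $G$ has at least one edge, for $c>0$ one has $\rho(G,H)\le c$ if and only if $t(H,W)\ge t(G,W)^c$ for every $W$. *)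

theory Defs
  imports "HOL-Analysis.Analysis"
begin

record 'v graph =
  verts :: "'v set"
  edges :: "'v set set"

definition simple_graph :: "'v graph \<Rightarrow> bool" where
  "simple_graph G \<longleftrightarrow> finite (verts G) \<and> (\<forall>e\<in>edges G. e \<subseteq> verts G \<and> card e = 2)"

definition complete_graph :: "nat \<Rightarrow> nat graph" where
  "complete_graph n = \<lparr>verts = {1..n}, edges = {e. e \<subseteq> {1..n} \<and> card e = 2}\<rparr>"

datatype kvertex = Central nat | Outer nat nat

text \<open>
  \<open>Central i\<close> is the clique vertex \<open>v\<^sub>i\<close>; \<open>Outer i k\<close>, for \<open>1 \<le> k \<le> a i\<close>, are the further
  vertices attached to the clique minus \<open>v\<^sub>i\<close>. Only \<open>a 1, \<dots>, a n\<close> matter.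
\<close>

definition K' :: "nat \<Rightarrow> (nat \<Rightarrow> nat) \<Rightarrow> kvertex graph" where
  "K' n a =
     \<lparr>verts = {Central i | i. i \<in> {1..n}} \<union> {Outer i k | i k. i \<in> {1..n} \<and> k \<in> {1..a i}},
      edges = {{Central i, Central j} | i j. i \<in> {1..n} \<and> j \<in> {1..n} \<and> i \<noteq> j}
            \<union> {{Outer i k, Central j} | i k j.
                 i \<in> {1..n} \<and> k \<in> {1..a i} \<and> j \<in> {1..n} \<and> j \<noteq> i}\<rparr>"

lemma simple_graph_complete_graph: "simple_graph (complete_graph n)"
  by (auto simp: simple_graph_def complete_graph_def)

lemma simple_graph_K': "simple_graph (K' n a)"
proof -
  have "{Outer i k | i k. i \<in> {1..n} \<and> k \<in> {1..a i}} = (\<Union>i\<in>{1..n}. Outer i ` {1..a i})"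
    by auto
  then have "finite {Outer i k | i k. i \<in> {1..n} \<and> k \<in> {1..a i}}"
    by simp
  then show ?thesis
    unfolding simple_graph_def K'_def by (fastforce simp: card_insert_if)
qed

definition graphon :: "(real \<Rightarrow> real \<Rightarrow> real) \<Rightarrow> bool" where
  "graphon W \<longleftrightarrow>
     case_prod W \<in> borel_measurable (restrict_space borel ({0..1} \<times> {0..1})) \<and>
     (\<forall>x\<in>{0..1}. \<forall>y\<in>{0..1}. W x y = W y x \<and> 0 \<le> W x y \<and> W x y \<le> 1)"

text \<open>
  The factor \<open>W (x u) (x v)\<close> of the edge \<open>{u, v}\<close>. Ordering the two arguments by size is one way
  to evaluate a symmetric \<open>W\<close> at an unordered pair; see the lemma below.
\<close>

definition edge_weight :: "(real \<Rightarrow> real \<Rightarrow> real) \<Rightarrow> ('v \<Rightarrow> real) \<Rightarrow> 'v set \<Rightarrow> real" where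
  "edge_weight W x e = W (Min (x ` e)) (Max (x ` e))"

lemma edge_weight_doubleton:
  assumes "graphon W" "x u \<in> {0..1}" "x v \<in> {0..1}"
  shows "edge_weight W x {u, v} = W (x u) (x v)"
  using assms by (auto simp: edge_weight_def graphon_def min_def max_def)

definition hom_density :: "'v graph \<Rightarrow> (real \<Rightarrow> real \<Rightarrow> real) \<Rightarrow> real" where
  "hom_density G W =
     (\<integral>x. (\<Prod>e\<in>edges G. edge_weight W x e) \<partial>(\<Pi>\<^sub>M v\<in>verts G. restrict_space lborel {0..1}))"

definition ext_ln :: "real \<Rightarrow> ereal" where
  "ext_ln t = (if t = 0 then - \<infinity> else ereal (ln t))"

text \<open>
  The supremum is taken in \<open>[0, \<infinity>]\<close>. All quotients are nonnegative, so inserting \<open>0\<close> matters only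
  if there is no admissible \<open>W\<close>, that is, if \<open>G\<close> has no edges.
\<close>

definition density_domination_exponent :: "'v graph \<Rightarrow> 'w graph \<Rightarrow> ereal" where
  "density_domination_exponent G H =
     Sup (insert 0 {ext_ln (hom_density H W) / ext_ln (hom_density G W) | W.
                      graphon W \<and> hom_density G W \<noteq> 0 \<and> hom_density G W \<noteq> 1})"

end

theory Submission
  imports "HOL-Probability.Infinite_Product_Measure" Defs
begin

text \<open>
  Upper bound. Let \<open>t\<close> be the density of \<open>K\<^sub>n\<close>, \<open>F\<close> the product of \<open>W\<close> over all pairs of an \<open>n\<close>-tuple,
  and \<open>d\<^sub>i\<close> the measure of the common neighbours of all coordinates but the \<open>i\<close>-th, so that \<open>K'\<^sub>a\<close> has
  density \<open>\<integral> F \<Prod> d\<^sub>i ^ a\<^sub>i\<close>. With \<open>u\<^sub>i = d\<^sub>i / t\<close>, the inequalities \<open>exp y \<ge> 1 + y\<close> and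
  \<open>ln u \<ge> 1 - 1 / u\<close> give \<open>\<Prod> u\<^sub>i ^ a\<^sub>i + \<Sum> a\<^sub>i / u\<^sub>i \<ge> 1 + \<Sum> a\<^sub>i\<close>. Integrate this against \<open>F\<close> and use
  \<open>\<integral> F / d\<^sub>i \<le> 1\<close>, which holds because integrating out the \<open>i\<close>-th coordinate turns \<open>F\<close> into \<open>d\<^sub>i\<close> times a
  factor at most \<open>1\<close>.

  Sharpness. It suffices to find graphs on \<open>N\<close> vertices with about \<open>N ^ (n - 1 - o(1))\<close> copies of \<open>K\<^sub>n\<close>,
  each determined by any \<open>n - 1\<close> of its vertices: then every outer vertex of \<open>K'\<^sub>a\<close> must be mapped to
  the same place as its twin in the clique. In the spirit of Behrend's construction, take \<open>n\<close> copies of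
  a box in \<open>\<int> ^ d\<close> and consider the \<open>n\<close>-tuples of vectors with sum \<open>0\<close>. By pigeonhole many of them share
  a Gram matrix \<open>c\<close>; join \<open>x\<close> in the \<open>i\<close>-th part and \<open>y\<close> in the \<open>j\<close>-th part if \<open>x \<bullet> y\<close>, \<open>x \<bullet> x\<close> and
  \<open>y \<bullet> y\<close> are the corresponding entries of \<open>c\<close>. The entries of \<open>c\<close> sum to \<open>0\<close>, so the vectors of any
  \<open>n\<close>-clique have a sum of norm \<open>0\<close>. The box has side about \<open>2 ^ d\<close>, and \<open>d\<close> tends to infinity.
\<close>

section \<open>Tilting bound\<close>

text \<open>Both elementary inequalities are tight at \<open>u i = 1\<close>, so equality holds when
  every \<open>u i\<close> is \<open>1\<close>. Indices with \<open>a i = 0\<close> contribute the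
  factor \<open>1\<close> and the summand \<open>0\<close>, so positivity is asked only where
  \<open>a i > 0\<close>.\<close>

lemma prod_power_plus_weighted_inverses_ge:
  fixes u :: "'i \<Rightarrow> real" and a :: "'i \<Rightarrow> nat"
  assumes "finite I" and pos: "\<And>i. i \<in> I \<Longrightarrow> a i > 0 \<Longrightarrow> u i > 0"
  shows "1 + (\<Sum>i\<in>I. real (a i)) \<le> (\<Prod>i\<in>I. u i ^ a i) + (\<Sum>i\<in>I. real (a i) / u i)"
proof -
  have exp_eq: "exp (real (a i) * ln (u i)) = u i ^ a i" if "i \<in> I" for i
    using pos[OF that] by (cases "a i = 0") (auto simp: exp_of_nat_mult)
  have "1 + (\<Sum>i\<in>I. real (a i) * ln (u i)) \<le> exp (\<Sum>i\<in>I. real (a i) * ln (u i))"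
    by (rule exp_ge_add_one_self)
  also have "\<dots> = (\<Prod>i\<in>I. u i ^ a i)"
    using \<open>finite I\<close> by (simp add: exp_sum exp_eq)
  finally have 1: "1 + (\<Sum>i\<in>I. real (a i) * ln (u i)) \<le> (\<Prod>i\<in>I. u i ^ a i)" .
  have "real (a i) * (1 - 1 / u i) \<le> real (a i) * ln (u i)" if "i \<in> I" for i
  proof (cases "a i = 0")
    case False
    then have "u i > 0" using pos that by simp
    then have "ln (1 / u i) \<le> 1 / u i - 1" by (intro ln_le_minus_one) simp
    then show ?thesis using \<open>u i > 0\<close> by (intro mult_left_mono) (auto simp: ln_div)
  qed simp
  then have "(\<Sum>i\<in>I. real (a i) * (1 - 1 / u i)) \<le> (\<Sum>i\<in>I. real (a i) * ln (u i))"
    by (rule sum_mono)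
  also have "(\<Sum>i\<in>I. real (a i) * (1 - 1 / u i)) = (\<Sum>i\<in>I. real (a i)) - (\<Sum>i\<in>I. real (a i) / u i)"
    by (simp add: right_diff_distrib sum_subtractf)
  finally show ?thesis using 1 by linarith
qed

text \<open>
  Division in \<^typ>\<open>ennreal\<close> has \<open>F / 0 = \<infinity>\<close> for \<open>F \<noteq> 0\<close> and \<open>0 / 0 = 0\<close>, so the inequality holds at every
  point and the zero sets of the \<open>d i\<close> need no separate treatment.
\<close>

lemma ennreal_prod_power_plus_weighted_inverses_ge:
  fixes d :: "'i \<Rightarrow> ennreal" and a :: "'i \<Rightarrow> nat"
  assumes "finite I" "t > 0" and fin: "F < top" "\<And>i. i \<in> I \<Longrightarrow> d i < top"
  shows "ennreal ((1 + real (sum a I)) * t ^ sum a I) * F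
      \<le> F * (\<Prod>i\<in>I. d i ^ a i) + (\<Sum>i\<in>I. ennreal (real (a i) * t ^ Suc (sum a I)) * (F / d i))"
\<comment> \<open>Degenerate case: either the left side is \<open>0\<close>, or a summand with
  \<open>d i = 0\<close> and \<open>a i > 0\<close> makes the right side infinite.\<close>
proof (cases "F = 0 \<or> (\<exists>i\<in>I. a i > 0 \<and> d i = 0)")
  case True
  show ?thesis
  proof (cases "F = 0")
    case False
    then obtain i where i: "i \<in> I" "a i > 0" "d i = 0" using True by auto
    then have "ennreal (real (a i) * t ^ Suc (sum a I)) * (F / d i) = top"
      using False \<open>t > 0\<close> by (simp add: ennreal_divide_zero ennreal_mult_top)
    moreover have "ennreal (real (a i) * t ^ Suc (sum a I)) * (F / d i)
        \<le> (\<Sum>i\<in>I. ennreal (real (a i) * t ^ Suc (sum a I)) * (F / d i))"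
      using i(1) \<open>finite I\<close> by (intro member_le_sum) auto
    ultimately have "(\<Sum>i\<in>I. ennreal (real (a i) * t ^ Suc (sum a I)) * (F / d i)) = top"
      by (simp add: top_unique)
    then show ?thesis by simp
  qed simp
next
  case False
  define f where "f = enn2real F"
  define \<delta> where "\<delta> i = enn2real (d i)" for i
  have "F > 0" using False by (intro zero_less_iff_neq_zero[THEN iffD2]) blast
  then have F: "F = ennreal f" "f > 0" using fin by (auto simp: f_def enn2real_positive_iff)
  have d: "d i = ennreal (\<delta> i)" "\<delta> i \<ge> 0" if "i \<in> I" for i using fin that by (auto simp: \<delta>_def)
  have \<delta>pos: "\<delta> i > 0" if "i \<in> I" "a i > 0" for i
    using False that d[OF that(1)] by (metis ennreal_0 less_eq_real_def)
  have "(1 + (\<Sum>i\<in>I. real (a i))) \<le> (\<Prod>i\<in>I. (\<delta> i / t) ^ a i) + (\<Sum>i\<in>I. real (a i) / (\<delta> i / t))"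
    using \<delta>pos \<open>t > 0\<close> by (intro prod_power_plus_weighted_inverses_ge \<open>finite I\<close>) auto
  \<comment> \<open>Multiplying by \<open>f * t ^ sum a I\<close> brings in the weight and turns the
    ratios \<open>\<delta> i / t\<close> into powers of \<open>t\<close> that do not vary with the
    point of integration.\<close>
  then have "(f * t ^ sum a I) * (1 + (\<Sum>i\<in>I. real (a i))) \<le> (f * t ^ sum a I) * ((\<Prod>i\<in>I. (\<delta> i / t) ^ a i) + (\<Sum>i\<in>I. real (a i) / (\<delta> i / t)))"
    using F \<open>t > 0\<close> by (intro mult_left_mono) auto
  also have "(\<Prod>i\<in>I. (\<delta> i / t) ^ a i) = (\<Prod>i\<in>I. \<delta> i ^ a i) / t ^ sum a I"
    by (simp add: power_divide prod_dividef power_sum)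
  also have "(f * t ^ sum a I) * (\<dots> + (\<Sum>i\<in>I. real (a i) / (\<delta> i / t)))
      = f * (\<Prod>i\<in>I. \<delta> i ^ a i) + (\<Sum>i\<in>I. real (a i) * t ^ Suc (sum a I) * (f / \<delta> i))"
    using \<open>t > 0\<close> by (simp add: distrib_left sum_distrib_left mult_ac)
  finally have *: "(1 + real (sum a I)) * t ^ sum a I * f \<le> f * (\<Prod>i\<in>I. \<delta> i ^ a i) + (\<Sum>i\<in>I. real (a i) * t ^ Suc (sum a I) * (f / \<delta> i))"
    by (simp add: mult_ac)
  have summand: "ennreal (real (a i) * t ^ Suc (sum a I)) * (F / d i) = ennreal (real (a i) * t ^ Suc (sum a I) * (f / \<delta> i))" if "i \<in> I" for i
  proof (cases "a i = 0")
    case False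
    then show ?thesis using \<delta>pos[of i] that d[OF that] F \<open>t > 0\<close> by (simp add: divide_ennreal ennreal_mult[symmetric])
  qed simp
  have "ennreal ((1 + real (sum a I)) * t ^ sum a I) * F = ennreal ((1 + real (sum a I)) * t ^ sum a I * f)"
    using F by (simp add: ennreal_mult'')
  also have "\<dots> \<le> ennreal (f * (\<Prod>i\<in>I. \<delta> i ^ a i) + (\<Sum>i\<in>I. real (a i) * t ^ Suc (sum a I) * (f / \<delta> i)))"
    using * by (rule ennreal_leI)
  also have "\<dots> = ennreal (f * (\<Prod>i\<in>I. \<delta> i ^ a i)) + ennreal (\<Sum>i\<in>I. real (a i) * t ^ Suc (sum a I) * (f / \<delta> i))"
    using F d \<open>t > 0\<close> by (intro ennreal_plus mult_nonneg_nonneg prod_nonneg sum_nonneg) auto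
  also have "ennreal (\<Sum>i\<in>I. real (a i) * t ^ Suc (sum a I) * (f / \<delta> i)) = (\<Sum>i\<in>I. ennreal (real (a i) * t ^ Suc (sum a I)) * (F / d i))"
    using summand F d \<open>t > 0\<close> by (subst sum_ennreal[symmetric]) auto
  also have "ennreal (f * (\<Prod>i\<in>I. \<delta> i ^ a i)) = F * (\<Prod>i\<in>I. d i ^ a i)"
    using F d by (simp add: ennreal_mult prod_nonneg prod_ennreal[symmetric] ennreal_power[symmetric] cong: prod.cong)
  finally show ?thesis .
qed

text \<open>With \<open>s = sum a I\<close>, integrating the pointwise inequality gives
  \<open>(1 + s) * t ^ Suc s\<close> on the left, while \<open>inv\<close> bounds the integrated
  inverse terms by \<open>s * t ^ Suc s\<close>. This amount is finite, so it can be cancelled in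
  \<open>ennreal\<close>.\<close>

lemma nn_integral_prod_power_ge:
  fixes F :: "'x \<Rightarrow> ennreal" and d :: "'i \<Rightarrow> 'x \<Rightarrow> ennreal" and a :: "'i \<Rightarrow> nat"
  assumes "finite I"
    and [measurable]: "F \<in> borel_measurable M" "\<And>i. i \<in> I \<Longrightarrow> d i \<in> borel_measurable M"
    and fin: "\<And>x. x \<in> space M \<Longrightarrow> F x < top" "\<And>i x. i \<in> I \<Longrightarrow> x \<in> space M \<Longrightarrow> d i x < top"
    and int: "(\<integral>\<^sup>+x. F x \<partial>M) = ennreal t" and "t \<ge> 0"
    and inv: "\<And>i. i \<in> I \<Longrightarrow> (\<integral>\<^sup>+x. F x / d i x \<partial>M) \<le> 1"
  shows "ennreal (t ^ Suc (sum a I)) \<le> (\<integral>\<^sup>+x. F x * (\<Prod>i\<in>I. d i x ^ a i) \<partial>M)"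
proof (cases "t = 0")
  case False
  then have "t > 0" using \<open>t \<ge> 0\<close> by simp
  define s where "s = sum a I"
  let ?J = "\<integral>\<^sup>+x. F x * (\<Prod>i\<in>I. d i x ^ a i) \<partial>M"
  have "ennreal (t ^ Suc s) + ennreal (real s * t ^ Suc s) = ennreal ((1 + real s) * t ^ s) * ennreal t"
    using \<open>t > 0\<close> by (simp add: ennreal_mult[symmetric] ennreal_plus[symmetric] algebra_simps del: ennreal_plus)
  also have "\<dots> = (\<integral>\<^sup>+x. ennreal ((1 + real s) * t ^ s) * F x \<partial>M)"
    by (simp add: nn_integral_cmult int)
  also have "\<dots> \<le> (\<integral>\<^sup>+x. F x * (\<Prod>i\<in>I. d i x ^ a i) + (\<Sum>i\<in>I. ennreal (real (a i) * t ^ Suc s) * (F x / d i x)) \<partial>M)"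
    unfolding s_def using fin \<open>t > 0\<close> \<open>finite I\<close>
    by (intro nn_integral_mono ennreal_prod_power_plus_weighted_inverses_ge) auto
  also have "\<dots> = ?J + (\<Sum>i\<in>I. ennreal (real (a i) * t ^ Suc s) * (\<integral>\<^sup>+x. F x / d i x \<partial>M))"
    by (simp add: nn_integral_add nn_integral_sum nn_integral_cmult)
  also have "\<dots> \<le> ?J + (\<Sum>i\<in>I. ennreal (real (a i) * t ^ Suc s) * 1)"
    using inv by (intro add_left_mono sum_mono mult_left_mono) auto
  also have "(\<Sum>i\<in>I. ennreal (real (a i) * t ^ Suc s) * 1) = ennreal (real s * t ^ Suc s)"
    using \<open>t > 0\<close> by (simp add: s_def sum_distrib_right sum_ennreal)
  finally show ?thesis unfolding s_def[symmetric] by (simp add: ennreal_add_left_cancel_le add.commute)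
qed simp

section \<open>Hom densities of graphons\<close>

abbreviation unit_measure :: "real measure" where
  "unit_measure \<equiv> restrict_space lborel {0..1}"

lemma prob_space_unit_measure: "prob_space unit_measure"
  by (rule prob_spaceI) (simp add: emeasure_restrict_space space_restrict_space)

interpretation unit: prob_space unit_measure
  by (rule prob_space_unit_measure)

lemma space_unit_measure: "space unit_measure = {0..1}"
  by (simp add: space_restrict_space)

lemma product_prob_space_unit_measure: "product_prob_space (\<lambda>_. unit_measure)"
  using prob_space_unit_measure
  by (simp add: product_prob_space_def product_prob_space_axioms_def product_sigma_finite_def prob_space_imp_sigma_finite)

text \<open>\<open>graphon\<close> constrains \<open>W\<close> on the unit square only, so the pair
  of \<open>f\<close> and \<open>g\<close> is first mapped into the Borel space restricted to that
  square.\<close>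

lemma measurable_graphon:
  assumes W: "graphon W" and f: "f \<in> measurable M unit_measure" and g: "g \<in> measurable M unit_measure"
  shows "(\<lambda>x. W (f x) (g x)) \<in> borel_measurable M"
proof -
  have "f \<in> borel_measurable M" "g \<in> borel_measurable M"
    using measurable_restrict_space2_iff f g by (metis measurable_lborel1)+
  moreover have "f \<in> space M \<rightarrow> {0..1}" "g \<in> space M \<rightarrow> {0..1}"
    using measurable_space[OF f] measurable_space[OF g] by (auto simp: space_unit_measure)
  ultimately have "(\<lambda>x. (f x, g x)) \<in> measurable M (restrict_space borel ({0..1} \<times> {0..1}))"
    by (intro measurable_restrict_space2) auto
  moreover have "case_prod W \<in> borel_measurable (restrict_space borel ({0..1} \<times> {0..1}))"
    using W by (simp add: graphon_def)
  ultimately have "(\<lambda>x. case_prod W (f x, g x)) \<in> borel_measurable M"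
    by (rule measurable_compose)
  then show ?thesis by simp
qed

lemma unit_PiM_component: "v \<in> V \<Longrightarrow> (\<lambda>x. x v) \<in> measurable (PiM V (\<lambda>_. unit_measure)) unit_measure"
  by (rule measurable_component_singleton)

lemma unit_PiM_mem: "x \<in> space (PiM V (\<lambda>_. unit_measure)) \<Longrightarrow> v \<in> V \<Longrightarrow> x v \<in> {0..1}"
  by (auto simp: space_PiM space_unit_measure dest: PiE_mem)

lemma graphon_bounds: "graphon W \<Longrightarrow> s \<in> {0..1} \<Longrightarrow> t \<in> {0..1} \<Longrightarrow> W s t \<in> {0..1}"
  by (auto simp: graphon_def)

lemma edge_weight_in_unit:
  assumes "graphon W" "card e = 2" "x ` e \<subseteq> {0..1}"
  shows "edge_weight W x e \<in> {0..1}"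
proof -
  obtain u v where "e = {u, v}" using assms(2) by (auto simp: card_2_iff)
  then show ?thesis using assms graphon_bounds[of W "x u" "x v"] by (simp add: edge_weight_doubleton)
qed

text \<open>On the product space the \<open>Min\<close> and \<open>Max\<close> of
  \<open>edge_weight\<close> disappear: by symmetry the weight is \<open>W (x u) (x v)\<close> for
  any naming of the two endpoints.\<close>

lemma measurable_edge_weight:
  assumes W: "graphon W" and e: "card e = 2" "e \<subseteq> V"
  shows "(\<lambda>x. edge_weight W x e) \<in> borel_measurable (PiM V (\<lambda>_. unit_measure))"
proof -
  obtain u v where uv: "e = {u, v}" using e by (auto simp: card_2_iff)
  then have "u \<in> V" "v \<in> V" using e by auto
  then have eq: "edge_weight W x e = W (x u) (x v)" if "x \<in> space (PiM V (\<lambda>_. unit_measure))" for x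
    using W uv unit_PiM_mem[OF that] by (simp add: edge_weight_doubleton)
  show ?thesis
    by (rule measurable_cong[THEN iffD2, OF eq], assumption)
      (intro measurable_graphon W unit_PiM_component \<open>u \<in> V\<close> \<open>v \<in> V\<close>)
qed

text \<open>The integrand lies between \<open>0\<close> and \<open>1\<close> on a probability space,
  hence is integrable. The passage to the nonnegative integral makes Tonelli available without
  integrability conditions.\<close>

lemma
  assumes W: "graphon W" and G: "simple_graph G"
  shows ennreal_hom_density: "ennreal (hom_density G W)
      = (\<integral>\<^sup>+x. (\<Prod>e\<in>edges G. ennreal (edge_weight W x e)) \<partial>PiM (verts G) (\<lambda>_. unit_measure))"
    and hom_density_nonneg: "0 \<le> hom_density G W"
    and hom_density_le_1: "hom_density G W \<le> 1"
proof -
  let ?M = "PiM (verts G) (\<lambda>_. unit_measure)"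
  let ?f = "\<lambda>x. \<Prod>e\<in>edges G. edge_weight W x e"
  interpret prob_space ?M
    by (intro prob_space_PiM prob_space_unit_measure)
  have e: "card e = 2" "e \<subseteq> verts G" if "e \<in> edges G" for e
    using G that by (auto simp: simple_graph_def)
  have ew: "edge_weight W x e \<in> {0..1}" if "x \<in> space ?M" "e \<in> edges G" for x e
    using e[OF that(2)] unit_PiM_mem[OF that(1)] by (intro edge_weight_in_unit W) auto
  have [measurable]: "?f \<in> borel_measurable ?M"
    using e W by (intro borel_measurable_prod measurable_edge_weight) auto
  have f: "0 \<le> ?f x" "?f x \<le> 1" if "x \<in> space ?M" for x
    using ew[OF that] by (auto intro!: prod_nonneg prod_le_1)
  have int: "integrable ?M ?f"
    using f by (intro integrable_const_bound[of _ 1] AE_I2) auto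
  show "0 \<le> hom_density G W"
    unfolding hom_density_def by (rule Bochner_Integration.integral_nonneg) (rule f)
  have "hom_density G W \<le> (\<integral>x. 1 \<partial>?M)"
    unfolding hom_density_def by (intro integral_mono int f) auto
  then show "hom_density G W \<le> 1" by (simp add: prob_space)
  have "ennreal (hom_density G W) = (\<integral>\<^sup>+x. ennreal (?f x) \<partial>?M)"
    unfolding hom_density_def by (intro nn_integral_eq_integral[symmetric] int AE_I2 f)
  also have "\<dots> = (\<integral>\<^sup>+x. (\<Prod>e\<in>edges G. ennreal (edge_weight W x e)) \<partial>?M)"
    using ew by (intro nn_integral_cong prod_ennreal[symmetric]) auto
  finally show "ennreal (hom_density G W) = \<dots>" .
qed

text \<open>All factors are equal, so an injective renaming of coordinates preserves the product
  measure. It serves to pass from the vertices \<open>Central i\<close> to the indices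
  \<open>i\<close>.\<close>

lemma nn_integral_unit_PiM_reindex:
  assumes f: "inj_on f I" and g: "g \<in> borel_measurable (PiM I (\<lambda>_. unit_measure))"
  shows "(\<integral>\<^sup>+x. g (\<lambda>i\<in>I. x (f i)) \<partial>PiM (f ` I) (\<lambda>_. unit_measure)) = (\<integral>\<^sup>+x. g x \<partial>PiM I (\<lambda>_. unit_measure))"
proof -
  let ?t = "\<lambda>x. \<lambda>i\<in>I. x (f i)"
  have "distr (PiM (f ` I) (\<lambda>_. unit_measure)) (PiM I (\<lambda>_. unit_measure)) ?t = PiM I (\<lambda>_. unit_measure)"
    using distr_PiM_reindex[of "f ` I" "\<lambda>_. unit_measure" f I] f prob_space_unit_measure by auto
  moreover have "?t \<in> measurable (PiM (f ` I) (\<lambda>_. unit_measure)) (PiM I (\<lambda>_. unit_measure))"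
    by (intro measurable_restrict unit_PiM_component) auto
  from nn_integral_distr[OF this, of g] have "(\<integral>\<^sup>+x. g x \<partial>distr (PiM (f ` I) (\<lambda>_. unit_measure)) (PiM I (\<lambda>_. unit_measure)) ?t)
      = (\<integral>\<^sup>+x. g (?t x) \<partial>PiM (f ` I) (\<lambda>_. unit_measure))"
    using g by simp
  ultimately show ?thesis by simp
qed

section \<open>Cliques and codegrees in a graphon\<close>

abbreviation clique_weight :: "nat \<Rightarrow> (real \<Rightarrow> real \<Rightarrow> real) \<Rightarrow> (nat \<Rightarrow> real) \<Rightarrow> ennreal" where
  "clique_weight n W x \<equiv> \<Prod>e\<in>edges (complete_graph n). ennreal (edge_weight W x e)"

text \<open>The quantity \<open>d\<^sub>i\<close> of the tilting argument. It takes the whole tuple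
  although it ignores \<open>x i\<close>, so that all codegrees are functions on one product
  space.\<close>

definition codegree :: "nat \<Rightarrow> (real \<Rightarrow> real \<Rightarrow> real) \<Rightarrow> nat \<Rightarrow> (nat \<Rightarrow> real) \<Rightarrow> ennreal" where
  "codegree n W i x = (\<integral>\<^sup>+s. (\<Prod>j\<in>{1..n} - {i}. ennreal (W s (x j))) \<partial>unit_measure)"

lemma finite_edges_complete_graph: "finite (edges (complete_graph n))"
  by (rule finite_subset[of _ "Pow {1..n}"]) (auto simp: complete_graph_def)

text \<open>Isolates the factors in which coordinate \<open>i\<close> occurs, in preparation for
  integrating that coordinate out.\<close>

lemma clique_weight_split:
  assumes "i \<in> {1..n}"
  shows "clique_weight n W x = (\<Prod>e\<in>{e \<in> edges (complete_graph n). i \<notin> e}. ennreal (edge_weight W x e))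
      * (\<Prod>j\<in>{1..n} - {i}. ennreal (edge_weight W x {i, j}))"
proof -
  let ?E = "edges (complete_graph n)"
  have "e \<in> (\<lambda>j. {i, j}) ` ({1..n} - {i})" if "e \<in> ?E" "i \<in> e" for e
    using that by (auto simp: complete_graph_def card_2_iff)
  moreover have "{i, j} \<in> ?E" if "j \<in> {1..n} - {i}" for j
    using that assms by (simp add: complete_graph_def)
  ultimately have E: "?E = {e \<in> ?E. i \<notin> e} \<union> (\<lambda>j. {i, j}) ` ({1..n} - {i})"
    by blast
  have "clique_weight n W x = (\<Prod>e\<in>{e \<in> ?E. i \<notin> e}. ennreal (edge_weight W x e))
      * (\<Prod>e\<in>(\<lambda>j. {i, j}) ` ({1..n} - {i}). ennreal (edge_weight W x e))"
    by (subst E, subst prod.union_disjoint) (auto simp: finite_edges_complete_graph)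
  also have "(\<Prod>e\<in>(\<lambda>j. {i, j}) ` ({1..n} - {i}). ennreal (edge_weight W x e))
      = (\<Prod>j\<in>{1..n} - {i}. ennreal (edge_weight W x {i, j}))"
    by (subst prod.reindex) (auto simp: inj_on_def doubleton_eq_iff)
  finally show ?thesis .
qed

lemma measurable_clique_weight:
  assumes "graphon W"
  shows "clique_weight n W \<in> borel_measurable (PiM {1..n} (\<lambda>_. unit_measure))"
proof -
  have "(\<lambda>x. ennreal (edge_weight W x e)) \<in> borel_measurable (PiM {1..n} (\<lambda>_. unit_measure))"
    if "e \<in> edges (complete_graph n)" for e
    using that by (intro measurable_compose[OF _ measurable_ennreal] measurable_edge_weight assms)
      (auto simp: complete_graph_def)
  then show ?thesis by (rule borel_measurable_prod_ennreal)
qed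

lemma measurable_codegree:
  assumes W: "graphon W"
  shows "codegree n W i \<in> borel_measurable (PiM {1..n} (\<lambda>_. unit_measure))"
proof -
  let ?M = "PiM {1..n} (\<lambda>_. unit_measure)"
  have "(\<lambda>p. ennreal (W (snd p) (fst p j))) \<in> borel_measurable (?M \<Otimes>\<^sub>M unit_measure)"
    if "j \<in> {1..n} - {i}" for j
    using that
    by (intro measurable_compose[OF _ measurable_ennreal] measurable_graphon[OF W] measurable_snd
        measurable_compose[OF measurable_fst unit_PiM_component]) auto
  then have "(\<lambda>p. \<Prod>j\<in>{1..n} - {i}. ennreal (W (snd p) (fst p j))) \<in> borel_measurable (?M \<Otimes>\<^sub>M unit_measure)"
    by (rule borel_measurable_prod_ennreal)
  then show ?thesis
    unfolding codegree_def by (intro unit.borel_measurable_nn_integral) (simp add: case_prod_beta)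
qed

lemma codegree_le_1:
  assumes W: "graphon W" and x: "\<And>j. j \<in> {1..n} - {i} \<Longrightarrow> x j \<in> {0..1}"
  shows "codegree n W i x \<le> 1"
proof -
  have "codegree n W i x \<le> (\<integral>\<^sup>+s. 1 \<partial>unit_measure)"
    unfolding codegree_def
  proof (intro nn_integral_mono prod_le_1)
    fix s j assume s: "s \<in> space unit_measure" and j: "j \<in> {1..n} - {i}"
    have "W s (x j) \<le> 1"
      using graphon_bounds[OF W, of s "x j"] s x[OF j] by (simp add: space_unit_measure)
    then show "0 \<le> ennreal (W s (x j)) \<and> ennreal (W s (x j)) \<le> 1" by simp
  qed
  then show ?thesis by (simp only: nn_integral_const unit.emeasure_space_1 mult_1)
qed

text \<open>Coordinate \<open>i\<close> is integrated innermost. The codegree does not depend on it,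
  the edges avoiding \<open>i\<close> form a constant factor \<open>G\<close> of size at most
  \<open>1\<close>, and the edges at \<open>i\<close> integrate to the codegree itself, which the
  division removes.\<close>

lemma nn_integral_clique_weight_divide_codegree_le:
  assumes W: "graphon W" and i: "i \<in> {1..n}"
  shows "(\<integral>\<^sup>+x. clique_weight n W x / codegree n W i x \<partial>PiM {1..n} (\<lambda>_. unit_measure)) \<le> 1"
proof -
  interpret product_prob_space "\<lambda>_::nat. unit_measure" "UNIV" by (rule product_prob_space_unit_measure)
  define J where "J = {1..n} - {i}"
  have J: "{1..n} = insert i J" "finite J" "i \<notin> J" using i by (auto simp: J_def)
  interpret J: prob_space "PiM J (\<lambda>_. unit_measure)" by (intro prob_space_PiM prob_space_unit_measure)
  have "(\<integral>\<^sup>+x. clique_weight n W x / codegree n W i x \<partial>PiM {1..n} (\<lambda>_. unit_measure))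
      = (\<integral>\<^sup>+x. (\<integral>\<^sup>+y. clique_weight n W (x(i := y)) / codegree n W i (x(i := y)) \<partial>unit_measure) \<partial>PiM J (\<lambda>_. unit_measure))"
    using measurable_clique_weight[OF W, of n] measurable_codegree[OF W, of n i] J(2,3)
    unfolding J(1) by (intro product_nn_integral_insert borel_measurable_divide_ennreal)
  also have "\<dots> \<le> (\<integral>\<^sup>+x. 1 \<partial>PiM J (\<lambda>_. unit_measure))"
  proof (rule nn_integral_mono)
    fix x assume x: "x \<in> space (PiM J (\<lambda>_. unit_measure))"
    define G where "G = (\<Prod>e\<in>{e \<in> edges (complete_graph n). i \<notin> e}. ennreal (edge_weight W x e))"
    have "G \<le> 1"
      unfolding G_def
    proof (intro prod_le_1 conjI zero_le)
      fix e assume "e \<in> {e \<in> edges (complete_graph n). i \<notin> e}"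
      then have "card e = 2" "e \<subseteq> J" by (auto simp: complete_graph_def J_def)
      then have "edge_weight W x e \<in> {0..1}"
        using unit_PiM_mem[OF x] by (intro edge_weight_in_unit W) auto
      then show "ennreal (edge_weight W x e) \<le> 1" by simp
    qed
    have weight: "clique_weight n W (x(i := y)) = G * (\<Prod>j\<in>J. ennreal (W y (x j)))" if y: "y \<in> {0..1}" for y
    proof -
      have "edge_weight W (x(i := y)) e = edge_weight W x e" if "i \<notin> e" for e
      proof -
        have "(x(i := y)) ` e = x ` e" using that by (intro image_cong) auto
        then show ?thesis by (simp only: edge_weight_def)
      qed
      moreover have "edge_weight W (x(i := y)) {i, j} = W y (x j)" if "j \<in> J" for j
        using edge_weight_doubleton[OF W, of "x(i := y)" i j] y unit_PiM_mem[OF x that] that by (auto simp: J_def)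
      ultimately show ?thesis
        unfolding clique_weight_split[OF i] G_def J_def[symmetric] by simp
    qed
    have codeg: "codegree n W i (x(i := y)) = codegree n W i x" for y
      unfolding codegree_def by (intro nn_integral_cong prod.cong) auto
    have P: "(\<lambda>y. \<Prod>j\<in>J. ennreal (W y (x j))) \<in> borel_measurable unit_measure"
      using unit_PiM_mem[OF x]
      by (intro borel_measurable_prod_ennreal measurable_compose[OF _ measurable_ennreal] measurable_graphon[OF W])
        (auto simp: space_unit_measure)
    have "(\<integral>\<^sup>+y. clique_weight n W (x(i := y)) / codegree n W i (x(i := y)) \<partial>unit_measure)
        = (\<integral>\<^sup>+y. G * (\<Prod>j\<in>J. ennreal (W y (x j))) / codegree n W i x \<partial>unit_measure)"
      by (intro nn_integral_cong) (simp add: weight codeg space_unit_measure)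
    also have "\<dots> = G * codegree n W i x / codegree n W i x"
      using P by (simp add: nn_integral_divide nn_integral_cmult codegree_def J_def)
    also have "\<dots> \<le> codegree n W i x / codegree n W i x"
      using \<open>G \<le> 1\<close> by (intro divide_right_mono_ennreal) (use mult_right_mono[of G 1 "codegree n W i x"] in simp)
    also have "\<dots> \<le> 1"
    \<comment> \<open>A zero codegree is harmless because \<open>0 / 0 = 0\<close>; otherwise the
      quotient is \<open>1\<close> because the codegree is finite.\<close>
    proof (cases "codegree n W i x = 0")
      case False
      have "codegree n W i x \<le> 1"
        using unit_PiM_mem[OF x] by (intro codegree_le_1 W) (simp add: J_def)
      then show ?thesis using False by (simp add: ennreal_divide_self le_less_trans)
    qed simp
    finally show "(\<integral>\<^sup>+y. clique_weight n W (x(i := y)) / codegree n W i (x(i := y)) \<partial>unit_measure) \<le> 1" .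
  qed
  also have "\<dots> = 1" by (simp add: J.emeasure_space_1)
  finally show ?thesis .
qed

text \<open>Outer vertices are pairwise nonadjacent. Once the clique is placed, the integrand
  therefore factors over them, and each of the \<open>a i\<close> vertices \<open>Outer i k\<close>
  integrates independently to the \<open>i\<close>-th codegree.\<close>

lemma ennreal_hom_density_K':
  assumes W: "graphon W"
  shows "ennreal (hom_density (K' n a) W)
    = (\<integral>\<^sup>+x. clique_weight n W x * (\<Prod>i\<in>{1..n}. codegree n W i x ^ a i) \<partial>PiM {1..n} (\<lambda>_. unit_measure))"
proof -
  interpret product_prob_space "\<lambda>_::kvertex. unit_measure" "UNIV" by (rule product_prob_space_unit_measure)
  define C where "C = Central ` {1..n}"
  define S where "S = Sigma {1..n} (\<lambda>i. {1..a i})"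
  define Q where "Q = (\<lambda>(i, k). Outer i k) ` S"
  \<comment> \<open>The two kinds of edges are written as disjoint images under injective maps, so
    that products over edges become products over indices.\<close>
  define E1 where "E1 = (`) Central ` edges (complete_graph n)"
  define T where "T = Sigma S (\<lambda>(i, k). {1..n} - {i})"
  define E2 where "E2 = (\<lambda>((i, k), j). {Outer i k, Central j}) ` T"
  define f where "f = (\<lambda>x. \<Prod>e\<in>edges (K' n a). ennreal (edge_weight W x e))"
  have "finite S" "finite T" unfolding S_def T_def by (auto intro!: finite_SigmaI)
  then have fin: "finite C" "finite Q" "finite S" "finite T" "finite E1" "finite E2"
    by (simp_all add: C_def Q_def E1_def E2_def finite_edges_complete_graph)
  have disj: "C \<inter> Q = {}" by (auto simp: C_def Q_def)
  have verts: "verts (K' n a) = C \<union> Q"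
    by (auto simp: K'_def C_def Q_def S_def)
  have "{{Central i, Central j} | i j. i \<in> {1..n} \<and> j \<in> {1..n} \<and> i \<noteq> j} = E1"
  proof (intro equalityI subsetI)
    fix e assume "e \<in> {{Central i, Central j} | i j. i \<in> {1..n} \<and> j \<in> {1..n} \<and> i \<noteq> j}"
    then obtain i j where "e = Central ` {i, j}" "i \<in> {1..n}" "j \<in> {1..n}" "i \<noteq> j" by auto
    then show "e \<in> E1" unfolding E1_def by (intro image_eqI[of _ _ "{i, j}"]) (auto simp: complete_graph_def)
  next
    fix e assume "e \<in> E1"
    then obtain e' where "e = Central ` e'" "e' \<subseteq> {1..n}" "card e' = 2"
      by (auto simp: E1_def complete_graph_def)
    then obtain i j where "e = {Central i, Central j}" "i \<in> {1..n}" "j \<in> {1..n}" "i \<noteq> j"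
      by (auto simp: card_2_iff)
    then show "e \<in> {{Central i, Central j} | i j. i \<in> {1..n} \<and> j \<in> {1..n} \<and> i \<noteq> j}"
      by blast
  qed
  moreover have "{{Outer i k, Central j} | i k j. i \<in> {1..n} \<and> k \<in> {1..a i} \<and> j \<in> {1..n} \<and> j \<noteq> i} = E2"
  proof (intro equalityI subsetI)
    fix e assume "e \<in> {{Outer i k, Central j} | i k j. i \<in> {1..n} \<and> k \<in> {1..a i} \<and> j \<in> {1..n} \<and> j \<noteq> i}"
    then obtain i k j where "e = {Outer i k, Central j}" "((i, k), j) \<in> T"
      by (auto simp: T_def S_def)
    then show "e \<in> E2" unfolding E2_def by (intro image_eqI[of _ _ "((i, k), j)"]) auto
  next
    fix e assume "e \<in> E2"
    then obtain i k j where "e = {Outer i k, Central j}" "((i, k), j) \<in> T"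
      unfolding E2_def by auto
    then show "e \<in> {{Outer i k, Central j} | i k j. i \<in> {1..n} \<and> k \<in> {1..a i} \<and> j \<in> {1..n} \<and> j \<noteq> i}"
      unfolding T_def S_def by blast
  qed
  ultimately have edges: "edges (K' n a) = E1 \<union> E2"
    by (simp add: K'_def)
  have disjE: "E1 \<inter> E2 = {}" by (auto simp: E1_def E2_def)
  have f_meas: "f \<in> borel_measurable (PiM (C \<union> Q) (\<lambda>_. unit_measure))"
  proof -
    have "(\<lambda>x. ennreal (edge_weight W x e)) \<in> borel_measurable (PiM (C \<union> Q) (\<lambda>_. unit_measure))"
      if "e \<in> edges (K' n a)" for e
      using simple_graph_K'[of n a] that unfolding verts[symmetric] simple_graph_def
      by (intro measurable_compose[OF _ measurable_ennreal] measurable_edge_weight W) auto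
    then show ?thesis unfolding f_def by (rule borel_measurable_prod_ennreal)
  qed
  define c where "c x = (\<lambda>i\<in>{1..n}. x (Central i))" for x :: "kvertex \<Rightarrow> real"
  \<comment> \<open>\<open>h x v s\<close> collects all edges at the outer vertex \<open>v\<close>
    when it sits at \<open>s\<close>. The value \<open>1\<close> at central vertices is a dummy, as
    the products below run over \<open>Q\<close>.\<close>
  define h where "h x v s = (case v of Outer i k \<Rightarrow> \<Prod>j\<in>{1..n} - {i}. ennreal (W s (x (Central j))) | _ \<Rightarrow> 1)"
    for x :: "kvertex \<Rightarrow> real" and v s
  have f_merge: "f (merge C Q (x, y)) = clique_weight n W (c x) * (\<Prod>v\<in>Q. h x v (y v))"
    if x: "x \<in> space (PiM C (\<lambda>_. unit_measure))" and y: "y \<in> space (PiM Q (\<lambda>_. unit_measure))" for x y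
  proof -
    let ?m = "merge C Q (x, y)"
    have "(\<Prod>e\<in>E1. ennreal (edge_weight W ?m e)) = (\<Prod>e\<in>edges (complete_graph n). ennreal (edge_weight W ?m (Central ` e)))"
      unfolding E1_def by (subst prod.reindex) (auto intro!: inj_onI simp: inj_image_eq_iff inj_def)
    also have "\<dots> = clique_weight n W (c x)"
    proof (rule prod.cong[OF refl])
      fix e assume "e \<in> edges (complete_graph n)"
      then have "e \<subseteq> {1..n}" by (simp add: complete_graph_def)
      then have "?m ` Central ` e = c x ` e"
        unfolding image_image by (intro image_cong) (auto simp: c_def merge_def C_def)
      then show "ennreal (edge_weight W ?m (Central ` e)) = ennreal (edge_weight W (c x) e)"
        by (simp only: edge_weight_def)
    qed
    finally have 1: "(\<Prod>e\<in>E1. ennreal (edge_weight W ?m e)) = clique_weight n W (c x)" .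
    have "(\<Prod>e\<in>E2. ennreal (edge_weight W ?m e)) = (\<Prod>((i, k), j)\<in>T. ennreal (edge_weight W ?m {Outer i k, Central j}))"
      unfolding E2_def by (subst prod.reindex) (auto simp: inj_on_def doubleton_eq_iff case_prod_beta)
    also have "\<dots> = (\<Prod>((i, k), j)\<in>T. ennreal (W (y (Outer i k)) (x (Central j))))"
    proof (rule prod.cong[OF refl], clarify)
      fix i k j assume "((i, k), j) \<in> T"
      then have "Outer i k \<in> Q" "Central j \<in> C" by (auto simp: T_def Q_def C_def)
      moreover from this disj have "Outer i k \<notin> C" by blast
      ultimately show "ennreal (edge_weight W ?m {Outer i k, Central j}) = ennreal (W (y (Outer i k)) (x (Central j)))"
        using unit_PiM_mem[OF x, of "Central j"] unit_PiM_mem[OF y, of "Outer i k"]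
        by (subst edge_weight_doubleton[OF W]) (auto simp: merge_def)
    qed
    also have "\<dots> = (\<Prod>p\<in>S. case p of (i, k) \<Rightarrow> \<Prod>j\<in>{1..n} - {i}. ennreal (W (y (Outer i k)) (x (Central j))))"
      unfolding T_def using fin by (subst prod.Sigma[symmetric]) (auto simp: case_prod_beta)
    also have "\<dots> = (\<Prod>v\<in>Q. h x v (y v))"
      unfolding Q_def by (subst prod.reindex) (auto simp: inj_on_def h_def case_prod_beta)
    finally show ?thesis
      using 1 fin disjE unfolding f_def edges by (simp add: prod.union_disjoint)
  qed
  have inner: "(\<integral>\<^sup>+y. f (merge C Q (x, y)) \<partial>PiM Q (\<lambda>_. unit_measure))
      = clique_weight n W (c x) * (\<Prod>i\<in>{1..n}. codegree n W i (c x) ^ a i)"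
    if x: "x \<in> space (PiM C (\<lambda>_. unit_measure))" for x
  proof -
    have h_meas: "h x v \<in> borel_measurable unit_measure" for v
    proof (cases v)
      case (Outer i k)
      have "(\<lambda>s. ennreal (W s (x (Central j)))) \<in> borel_measurable unit_measure" if "j \<in> {1..n} - {i}" for j
        using unit_PiM_mem[OF x, of "Central j"] that
        by (intro measurable_compose[OF _ measurable_ennreal] measurable_graphon[OF W])
          (auto simp: space_unit_measure C_def)
      then show ?thesis unfolding h_def Outer by (simp add: borel_measurable_prod_ennreal)
    next
      case (Central i)
      then show ?thesis unfolding h_def by simp
    qed
    have "(\<integral>\<^sup>+y. f (merge C Q (x, y)) \<partial>PiM Q (\<lambda>_. unit_measure))
        = (\<integral>\<^sup>+y. clique_weight n W (c x) * (\<Prod>v\<in>Q. h x v (y v)) \<partial>PiM Q (\<lambda>_. unit_measure))"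
      by (intro nn_integral_cong f_merge x)
    also have "\<dots> = clique_weight n W (c x) * (\<integral>\<^sup>+y. (\<Prod>v\<in>Q. h x v (y v)) \<partial>PiM Q (\<lambda>_. unit_measure))"
      by (intro nn_integral_cmult borel_measurable_prod_ennreal measurable_compose[OF unit_PiM_component h_meas])
    also have "(\<integral>\<^sup>+y. (\<Prod>v\<in>Q. h x v (y v)) \<partial>PiM Q (\<lambda>_. unit_measure)) = (\<Prod>v\<in>Q. \<integral>\<^sup>+s. h x v s \<partial>unit_measure)"
      by (intro product_nn_integral_prod fin h_meas)
    also have "\<dots> = (\<Prod>(i, k)\<in>S. codegree n W i (c x))"
      unfolding Q_def
      by (subst prod.reindex) (auto simp: inj_on_def h_def codegree_def c_def case_prod_beta intro!: prod.cong nn_integral_cong)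
    also have "\<dots> = (\<Prod>i\<in>{1..n}. \<Prod>k\<in>{1..a i}. codegree n W i (c x))"
      unfolding S_def by (subst prod.Sigma[symmetric]) auto
    also have "\<dots> = (\<Prod>i\<in>{1..n}. codegree n W i (c x) ^ a i)" by simp
    finally show ?thesis .
  qed
  have "ennreal (hom_density (K' n a) W) = (\<integral>\<^sup>+x. f x \<partial>PiM (C \<union> Q) (\<lambda>_. unit_measure))"
    unfolding ennreal_hom_density[OF W simple_graph_K'] f_def verts ..
  also have "\<dots> = (\<integral>\<^sup>+x. (\<integral>\<^sup>+y. f (merge C Q (x, y)) \<partial>PiM Q (\<lambda>_. unit_measure)) \<partial>PiM C (\<lambda>_. unit_measure))"
    by (intro product_nn_integral_fold disj fin f_meas)
  also have "\<dots> = (\<integral>\<^sup>+x. clique_weight n W (c x) * (\<Prod>i\<in>{1..n}. codegree n W i (c x) ^ a i) \<partial>PiM C (\<lambda>_. unit_measure))"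
    by (intro nn_integral_cong inner)
  also have "\<dots> = (\<integral>\<^sup>+x. clique_weight n W x * (\<Prod>i\<in>{1..n}. codegree n W i x ^ a i) \<partial>PiM {1..n} (\<lambda>_. unit_measure))"
    unfolding C_def c_def
    by (intro nn_integral_unit_PiM_reindex[where g = "\<lambda>x. clique_weight n W x * (\<Prod>i\<in>{1..n}. codegree n W i x ^ a i)"]
        borel_measurable_times_ennreal borel_measurable_prod_ennreal borel_measurable_power_ennreal
        measurable_clique_weight measurable_codegree W inj_onI) simp
  finally show ?thesis .
qed

text \<open>The integrated tilting bound, with the clique weight as \<open>F\<close> and the
  codegrees as \<open>d i\<close>.\<close>

lemma hom_density_K'_ge:
  assumes W: "graphon W"
  shows "hom_density (complete_graph n) W ^ Suc (\<Sum>i\<in>{1..n}. a i) \<le> hom_density (K' n a) W"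
proof -
  let ?t = "hom_density (complete_graph n) W"
  let ?M = "PiM {1..n} (\<lambda>_. unit_measure)"
  have t: "(\<integral>\<^sup>+x. clique_weight n W x \<partial>?M) = ennreal ?t"
    using ennreal_hom_density[OF W simple_graph_complete_graph[of n]]
    by (simp only: complete_graph_def graph.simps)
  have lt_top: "(\<Prod>e\<in>E. ennreal (edge_weight W x e)) < top" for x E
    by (induction E rule: infinite_finite_induct) (auto simp: ennreal_mult_less_top)
  have "ennreal (?t ^ Suc (\<Sum>i\<in>{1..n}. a i))
      \<le> (\<integral>\<^sup>+x. clique_weight n W x * (\<Prod>i\<in>{1..n}. codegree n W i x ^ a i) \<partial>?M)"
  proof (rule nn_integral_prod_power_ge[OF _ _ _ _ _ t])
    show "codegree n W i x < top" if "x \<in> space ?M" for i x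
      using codegree_le_1[OF W, of n i x] unit_PiM_mem[OF that] by (auto intro: le_less_trans)
    show "(\<integral>\<^sup>+x. clique_weight n W x / codegree n W i x \<partial>?M) \<le> 1" if "i \<in> {1..n}" for i
      by (rule nn_integral_clique_weight_divide_codegree_le[OF W that])
  qed (simp_all only: lt_top measurable_clique_weight[OF W] measurable_codegree[OF W]
      hom_density_nonneg[OF W simple_graph_complete_graph] finite_atLeastAtMost)
  then have "ennreal (?t ^ Suc (\<Sum>i\<in>{1..n}. a i)) \<le> ennreal (hom_density (K' n a) W)"
    by (simp only: ennreal_hom_density_K'[OF W])
  then show ?thesis
    by (simp add: hom_density_nonneg[OF W simple_graph_K'])
qed

section \<open>Graphs whose cliques are determined by their facets\<close>

text \<open>Maps are extensional so that each homomorphism is counted once. Since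
  \<open>{u, v} = {v, u}\<close>, the condition asks for \<open>E\<close> in both directions along
  every edge.\<close>

definition homs :: "'v graph \<Rightarrow> nat \<Rightarrow> (nat \<Rightarrow> nat \<Rightarrow> bool) \<Rightarrow> ('v \<Rightarrow> nat) set" where
  "homs G N E = {\<phi> \<in> verts G \<rightarrow>\<^sub>E {..<N}. \<forall>u v. {u, v} \<in> edges G \<longrightarrow> E (\<phi> u) (\<phi> v)}"

lemma finite_homs: "finite (verts G) \<Longrightarrow> finite (homs G N E)"
  unfolding homs_def by (rule finite_subset[OF Collect_restrict]) (intro finite_PiE finite_lessThan)

definition clique_map :: "nat \<Rightarrow> ('w \<Rightarrow> 'w \<Rightarrow> bool) \<Rightarrow> (nat \<Rightarrow> 'w) \<Rightarrow> bool" where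
  "clique_map n E \<phi> \<longleftrightarrow> (\<forall>i\<in>{1..n}. \<forall>j\<in>{1..n}. i \<noteq> j \<longrightarrow> E (\<phi> i) (\<phi> j))"

lemma homs_complete_graph:
  "homs (complete_graph n) N E = {\<phi> \<in> {1..n} \<rightarrow>\<^sub>E {..<N}. clique_map n E \<phi>}"
proof -
  have "{u, v} \<in> edges (complete_graph n) \<longleftrightarrow> u \<in> {1..n} \<and> v \<in> {1..n} \<and> u \<noteq> v" for u v
    by (cases "u = v") (auto simp: complete_graph_def)
  then show ?thesis
    unfolding homs_def clique_map_def by (auto simp: complete_graph_def)
qed

section \<open>Gram graphs, whose cliques are zero-sum families of vectors\<close>

definition dot :: "nat \<Rightarrow> (nat \<Rightarrow> int) \<Rightarrow> (nat \<Rightarrow> int) \<Rightarrow> int" where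
  "dot d x y = (\<Sum>k<d. x k * y k)"

text \<open>A vertex is a part together with a vector. Norms are tested along with the inner product
  because, without loops, the diagonal entries of the Gram matrix of a clique would otherwise stay
  uncontrolled.\<close>

definition gram_adj :: "nat \<Rightarrow> (nat \<times> nat \<Rightarrow> int) \<Rightarrow> nat \<times> (nat \<Rightarrow> int) \<Rightarrow> nat \<times> (nat \<Rightarrow> int) \<Rightarrow> bool" where
  "gram_adj d c p q \<longleftrightarrow> fst p \<noteq> fst q \<and> dot d (snd p) (snd q) = c (fst p, fst q)
     \<and> dot d (snd p) (snd p) = c (fst p, fst p) \<and> dot d (snd q) (snd q) = c (fst q, fst q)"

text \<open>By bilinearity, both sides are the squared norm of the sum of the vectors.\<close>

lemma sum_dot_eq:
  "(\<Sum>i\<in>I. \<Sum>j\<in>I. dot d (x i) (x j)) = (\<Sum>k<d. (\<Sum>i\<in>I. x i k)\<^sup>2)"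
proof -
  have "(\<Sum>i\<in>I. \<Sum>j\<in>I. dot d (x i) (x j)) = (\<Sum>i\<in>I. \<Sum>k<d. \<Sum>j\<in>I. x i k * x j k)"
    unfolding dot_def by (intro sum.cong refl sum.swap)
  also have "\<dots> = (\<Sum>k<d. \<Sum>i\<in>I. \<Sum>j\<in>I. x i k * x j k)"
    by (rule sum.swap)
  finally show ?thesis by (simp add: power2_eq_square sum_product)
qed

context
  fixes n d :: nat and c :: "nat \<times> nat \<Rightarrow> int"
  assumes n: "n \<ge> 2" and c0: "(\<Sum>i\<in>{1..n}. \<Sum>j\<in>{1..n}. c (i, j)) = 0"
begin

text \<open>Adjacent vertices lie in different parts, and there are as many parts as clique
  vertices. A clique may still visit the parts in any order.\<close>

lemma gram_clique_bij:
  assumes "clique_map n (gram_adj d c) \<phi>" "\<And>i. i \<in> {1..n} \<Longrightarrow> fst (\<phi> i) \<in> {1..n}"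
  shows "bij_betw (\<lambda>i. fst (\<phi> i)) {1..n} {1..n}"
proof -
  have "inj_on (\<lambda>i. fst (\<phi> i)) {1..n}"
    using assms(1) unfolding clique_map_def gram_adj_def by (meson inj_onI)
  moreover have "(\<lambda>i. fst (\<phi> i)) ` {1..n} \<subseteq> {1..n}"
    using assms(2) by blast
  ultimately show ?thesis
    by (intro bij_betw_imageI endo_inj_surj) auto
qed

text \<open>Up to a permutation of the parts the Gram matrix of the clique is \<open>c\<close>, so
  the squared norm of the vector sum is the entry sum of \<open>c\<close>, which is
  \<open>0\<close>.\<close>

lemma gram_clique_sum_eq_0:
  assumes \<phi>: "clique_map n (gram_adj d c) \<phi>" and V: "\<And>i. i \<in> {1..n} \<Longrightarrow> fst (\<phi> i) \<in> {1..n}" and "k < d"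
  shows "(\<Sum>i\<in>{1..n}. snd (\<phi> i) k) = 0"
proof -
  have dot: "dot d (snd (\<phi> i)) (snd (\<phi> j)) = c (fst (\<phi> i), fst (\<phi> j))" if "i \<in> {1..n}" "j \<in> {1..n}" for i j
  proof (cases "i = j")
    case True
    \<comment> \<open>The norm of the vector at \<open>i\<close> is read off from an edge to any
      other clique vertex \<open>l\<close>, which exists because \<open>n \<ge> 2\<close>.\<close>
    define l :: nat where "l = (if i = 1 then 2 else 1)"
    have "l \<in> {1..n}" "l \<noteq> i" using n by (auto simp: l_def)
    then show ?thesis using \<phi> True that unfolding clique_map_def gram_adj_def by blast
  qed (use \<phi> that in \<open>auto simp: clique_map_def gram_adj_def\<close>)
  note bij = gram_clique_bij[OF \<phi> V]
  have "(\<Sum>k<d. (\<Sum>i\<in>{1..n}. snd (\<phi> i) k)\<^sup>2) = (\<Sum>i\<in>{1..n}. \<Sum>j\<in>{1..n}. dot d (snd (\<phi> i)) (snd (\<phi> j)))"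
    by (rule sum_dot_eq[symmetric])
  also have "\<dots> = (\<Sum>i\<in>{1..n}. \<Sum>j\<in>{1..n}. c (fst (\<phi> i), fst (\<phi> j)))"
    by (intro sum.cong refl dot)
  also have "\<dots> = (\<Sum>i\<in>{1..n}. \<Sum>j\<in>{1..n}. c (fst (\<phi> i), j))"
    by (intro sum.cong refl sum.reindex_bij_betw[OF bij])
  also have "\<dots> = 0"
    using sum.reindex_bij_betw[OF bij, of "\<lambda>i. \<Sum>j\<in>{1..n}. c (i, j)"] c0 by simp
  finally show ?thesis
    using \<open>k < d\<close> by (subst (asm) sum_nonneg_eq_0_iff) auto
qed

text \<open>The vector at \<open>i\<close> is minus the sum of the others, and its part is the one
  that the others leave over.\<close>

lemma gram_clique_unique:
  assumes \<phi>: "clique_map n (gram_adj d c) \<phi>" "\<And>i. i \<in> {1..n} \<Longrightarrow> \<phi> i \<in> {1..n} \<times> ({..<d} \<rightarrow>\<^sub>E X)"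
    and \<psi>: "clique_map n (gram_adj d c) \<psi>" "\<And>i. i \<in> {1..n} \<Longrightarrow> \<psi> i \<in> {1..n} \<times> ({..<d} \<rightarrow>\<^sub>E X)"
    and i: "i \<in> {1..n}" and eq: "\<And>j. j \<in> {1..n} - {i} \<Longrightarrow> \<phi> j = \<psi> j"
  shows "\<phi> i = \<psi> i"
proof (rule prod_eqI)
  have V: "fst (\<phi> i) \<in> {1..n}" "fst (\<psi> i) \<in> {1..n}" if "i \<in> {1..n}" for i
    using \<phi>(2)[OF that] \<psi>(2)[OF that] by (simp_all add: mem_Times_iff)
  have split_nat: "(\<Sum>j\<in>{1..n}. f j) = f i + (\<Sum>j\<in>{1..n} - {i}. f j)" for f :: "nat \<Rightarrow> nat"
    using i by (intro sum.remove) auto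
  have split_int: "(\<Sum>j\<in>{1..n}. f j) = f i + (\<Sum>j\<in>{1..n} - {i}. f j)" for f :: "nat \<Rightarrow> int"
    using i by (intro sum.remove) auto
  \<comment> \<open>The part is recovered from the sum of all part labels, which is the sum of
    \<open>{1..n}\<close> for both cliques.\<close>
  have "(\<Sum>j\<in>{1..n}. fst (\<phi> j)) = (\<Sum>j\<in>{1..n}. fst (\<psi> j))"
    using sum.reindex_bij_betw[OF gram_clique_bij[OF \<phi>(1) V(1)], of "\<lambda>j. j"]
      sum.reindex_bij_betw[OF gram_clique_bij[OF \<psi>(1) V(2)], of "\<lambda>j. j"] by metis
  moreover have "(\<Sum>j\<in>{1..n} - {i}. fst (\<phi> j)) = (\<Sum>j\<in>{1..n} - {i}. fst (\<psi> j))"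
    by (intro sum.cong refl arg_cong[where f = fst] eq)
  ultimately show "fst (\<phi> i) = fst (\<psi> i)"
    unfolding split_nat by linarith
  have "snd (\<phi> i) k = snd (\<psi> i) k" if "k < d" for k
  proof -
    have "(\<Sum>j\<in>{1..n}. snd (\<phi> j) k) = (\<Sum>j\<in>{1..n}. snd (\<psi> j) k)"
      using gram_clique_sum_eq_0[OF \<phi>(1) V(1) that] gram_clique_sum_eq_0[OF \<psi>(1) V(2) that] by simp
    moreover have "(\<Sum>j\<in>{1..n} - {i}. snd (\<phi> j) k) = (\<Sum>j\<in>{1..n} - {i}. snd (\<psi> j) k)"
      by (intro sum.cong refl) (simp add: eq)
    ultimately show ?thesis unfolding split_int by linarith
  qed
  moreover have "snd (\<phi> i) \<in> {..<d} \<rightarrow>\<^sub>E X" "snd (\<psi> i) \<in> {..<d} \<rightarrow>\<^sub>E X"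
    using \<phi>(2)[OF i] \<psi>(2)[OF i] by (simp_all add: mem_Times_iff)
  ultimately show "snd (\<phi> i) = snd (\<psi> i)"
    by (intro PiE_ext) auto
qed

end

section \<open>Counting zero-sum tuples and choosing a popular Gram matrix\<close>

definition zero_sum_tuples :: "nat \<Rightarrow> nat \<Rightarrow> int \<Rightarrow> (nat \<Rightarrow> nat \<Rightarrow> int) set" where
  "zero_sum_tuples n d L = {p \<in> {1..n} \<rightarrow>\<^sub>E ({..<d} \<rightarrow>\<^sub>E {-L..L}). \<forall>k<d. (\<Sum>i\<in>{1..n}. p i k) = 0}"

lemma finite_zero_sum_tuples: "finite (zero_sum_tuples n d L)"
proof (rule finite_subset)
  show "zero_sum_tuples n d L \<subseteq> {1..n} \<rightarrow>\<^sub>E ({..<d} \<rightarrow>\<^sub>E {-L..L})"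
    unfolding zero_sum_tuples_def by blast
qed (intro finite_PiE finite_atLeastAtMost finite_lessThan finite_atLeastAtMost_int)

text \<open>The first \<open>n - 1\<close> vectors are free with entries in \<open>{0..<M}\<close>,
  and the last is minus their sum. The radius \<open>n * M\<close> leaves room for the entries of
  the last vector.\<close>

lemma card_zero_sum_tuples_ge:
  assumes "n \<ge> 1"
  shows "M ^ (d * (n - 1)) \<le> card (zero_sum_tuples n d (int (n * M)))"
proof -
  define Q where "Q = {1..<n} \<rightarrow>\<^sub>E ({..<d} \<rightarrow>\<^sub>E {0..<int M})"
  define f where "f q = (\<lambda>i\<in>{1..n}. \<lambda>k\<in>{..<d}. if i = n then - (\<Sum>j\<in>{1..<n}. q j k) else q i k)"
    for q :: "nat \<Rightarrow> nat \<Rightarrow> int"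
  have "card Q = M ^ (d * (n - 1))"
    by (simp add: Q_def card_PiE power_mult)
  moreover have "card Q \<le> card (zero_sum_tuples n d (int (n * M)))"
  proof (rule card_inj_on_le[of f])
    show "inj_on f Q"
    proof (rule inj_onI)
      fix p q assume pq: "p \<in> Q" "q \<in> Q" "f p = f q"
      have "p i k = q i k" if "i \<in> {1..<n}" "k < d" for i k
        using fun_cong[OF fun_cong[OF pq(3), of i], of k] that by (simp add: f_def)
      then have "p i = q i" if "i \<in> {1..<n}" for i
        using PiE_mem[OF pq(1)[unfolded Q_def]] PiE_mem[OF pq(2)[unfolded Q_def]] that
        by (intro PiE_ext[of _ "{..<d}" "\<lambda>_. {0..<int M}"]) simp_all
      then show "p = q"
        by (intro PiE_ext[OF pq(1)[unfolded Q_def] pq(2)[unfolded Q_def]])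
    qed
    show "f ` Q \<subseteq> zero_sum_tuples n d (int (n * M))"
    proof (rule image_subsetI)
      fix q assume "q \<in> Q"
      then have b: "0 \<le> q i k" "q i k < int M" if "i \<in> {1..<n}" "k < d" for i k
        using PiE_mem[OF PiE_mem[OF \<open>q \<in> Q\<close>[unfolded Q_def] that(1)], of k] that(2) by simp_all
      have s: "0 \<le> (\<Sum>j\<in>{1..<n}. q j k)" "(\<Sum>j\<in>{1..<n}. q j k) \<le> int (n * M)" if "k < d" for k
      proof -
        show "0 \<le> (\<Sum>j\<in>{1..<n}. q j k)" using b that by (intro sum_nonneg) auto
        have "(\<Sum>j\<in>{1..<n}. q j k) \<le> (\<Sum>j\<in>{1..<n}. int M)" using b that by (intro sum_mono) force
        also have "\<dots> \<le> int (n * M)" using assms by (simp add: of_nat_diff algebra_simps)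
        finally show "(\<Sum>j\<in>{1..<n}. q j k) \<le> int (n * M)" .
      qed
      have le: "int M \<le> int (n * M)" using assms by (simp add: mult_le_cancel_right1)
      have "f q i k \<in> {- int (n * M)..int (n * M)}" if "i \<in> {1..n}" "k < d" for i k
      proof (cases "i = n")
        case True
        then show ?thesis using s[OF that(2)] that by (simp add: f_def)
      next
        case False
        then have "0 \<le> q i k" "q i k < int M" using b[of i k] that by auto
        with le have "0 \<le> q i k" "q i k \<le> int (n * M)" by linarith+
        then show ?thesis using False that by (simp add: f_def)
      qed
      moreover have "(\<Sum>i\<in>{1..n}. f q i k) = 0" if "k < d" for k
      proof -
        have "{1..n} = insert n {1..<n}" using assms by auto
        moreover have "(\<Sum>i\<in>{1..<n}. f q i k) = (\<Sum>i\<in>{1..<n}. q i k)"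
          using that by (intro sum.cong) (auto simp: f_def)
        ultimately show ?thesis using that assms by (simp add: f_def)
      qed
      ultimately show "f q \<in> zero_sum_tuples n d (int (n * M))"
        unfolding zero_sum_tuples_def by (auto simp: f_def)
    qed
  qed (rule finite_zero_sum_tuples)
  ultimately show ?thesis by simp
qed

text \<open>Pigeonhole: a Gram matrix has \<open>n\<^sup>2\<close> entries, each an integer of
  absolute value at most \<open>d * L\<^sup>2\<close>.\<close>

lemma popular_gram_matrix:
  assumes "L \<ge> 0"
  obtains c where
    "card (zero_sum_tuples n d L)
      \<le> card {p \<in> zero_sum_tuples n d L. \<forall>i\<in>{1..n}. \<forall>j\<in>{1..n}. dot d (p i) (p j) = c (i, j)}
        * nat (2 * int d * L\<^sup>2 + 1) ^ n\<^sup>2"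
proof -
  define B where "B = int d * L\<^sup>2"
  define g where "g p = (\<lambda>ij\<in>{1..n} \<times> {1..n}. dot d (p (fst ij)) (p (snd ij)))"
    for p :: "nat \<Rightarrow> nat \<Rightarrow> int"
  define R where "R = {1..n} \<times> {1..n} \<rightarrow>\<^sub>E {-B..B}"
  have "B \<ge> 0" unfolding B_def by simp
  have "\<bar>dot d x y\<bar> \<le> B" if "x \<in> {..<d} \<rightarrow>\<^sub>E {-L..L}" "y \<in> {..<d} \<rightarrow>\<^sub>E {-L..L}" for x y
  proof -
    have "\<bar>dot d x y\<bar> \<le> (\<Sum>k<d. \<bar>x k * y k\<bar>)" unfolding dot_def by (rule sum_abs)
    also have "\<dots> \<le> (\<Sum>k<d. L\<^sup>2)"
    proof (rule sum_mono)
      fix k assume "k \<in> {..<d}"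
      then have "\<bar>x k\<bar> \<le> L" "\<bar>y k\<bar> \<le> L" using PiE_mem[OF that(1)] PiE_mem[OF that(2)] by force+
      then show "\<bar>x k * y k\<bar> \<le> L\<^sup>2"
        unfolding abs_mult power2_eq_square by (intro mult_mono) auto
    qed
    finally show ?thesis by (simp add: B_def)
  qed
  note dot_le = this
  have "g p \<in> R" if "p \<in> zero_sum_tuples n d L" for p
  proof -
    have "p i \<in> {..<d} \<rightarrow>\<^sub>E {-L..L}" if "i \<in> {1..n}" for i
      using \<open>p \<in> zero_sum_tuples n d L\<close> that unfolding zero_sum_tuples_def by (blast dest: PiE_mem)
    then have "dot d (p i) (p j) \<in> {-B..B}" if "i \<in> {1..n}" "j \<in> {1..n}" for i j
      using dot_le that by (simp add: abs_le_iff minus_le_iff)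
    then show ?thesis unfolding g_def R_def restrict_PiE_iff by force
  qed
  then have "g \<in> zero_sum_tuples n d L \<rightarrow> R" by blast
  moreover have "finite R" unfolding R_def by (auto simp: finite_PiE)
  moreover have "R \<noteq> {}" using \<open>B \<ge> 0\<close> unfolding R_def by (auto simp: PiE_eq_empty_iff)
  ultimately obtain c where "card (zero_sum_tuples n d L) \<le> card (g -` {c} \<inter> zero_sum_tuples n d L) * card R"
    using pigeonhole_card finite_zero_sum_tuples by metis
  also have "card R = nat (2 * int d * L\<^sup>2 + 1) ^ n\<^sup>2"
    using \<open>B \<ge> 0\<close> unfolding R_def by (simp add: card_PiE B_def power2_eq_square mult_ac)
  also have "card (g -` {c} \<inter> zero_sum_tuples n d L)
      \<le> card {p \<in> zero_sum_tuples n d L. \<forall>i\<in>{1..n}. \<forall>j\<in>{1..n}. dot d (p i) (p j) = c (i, j)}"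
    by (intro card_mono) (auto simp: finite_zero_sum_tuples g_def)
  finally show thesis using that by (simp add: mult_right_mono)
qed

section \<open>The graph for sharpness and its homomorphism counts\<close>

definition facets_determine_cliques :: "nat \<Rightarrow> nat \<Rightarrow> (nat \<Rightarrow> nat \<Rightarrow> bool) \<Rightarrow> bool" where
  "facets_determine_cliques n N E \<longleftrightarrow>
     (\<forall>\<phi> \<psi>. \<forall>i\<in>{1..n}. \<phi> \<in> {1..n} \<rightarrow> {..<N} \<longrightarrow> \<psi> \<in> {1..n} \<rightarrow> {..<N} \<longrightarrow> clique_map n E \<phi> \<longrightarrow> clique_map n E \<psi>
       \<longrightarrow> (\<forall>j\<in>{1..n} - {i}. \<phi> j = \<psi> j) \<longrightarrow> \<phi> i = \<psi> i)"

text \<open>The Gram graph of a popular matrix, with its vertices numbered by a bijection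
  \<open>b\<close>: each of the \<open>n\<close> parts holds the
  \<open>(2 * (n * M) + 1) ^ d\<close> vectors of the box.\<close>

lemma facets_determine_cliques_graph:
  assumes n: "n \<ge> 2" and M: "M \<ge> 1" and N: "N = n * (2 * (n * M) + 1) ^ d"
  shows "\<exists>E. (\<forall>u<N. \<forall>v<N. E u v \<longrightarrow> E v u) \<and> (\<forall>u. \<not> E u u) \<and> facets_determine_cliques n N E
    \<and> M ^ (d * (n - 1)) \<le> card (homs (complete_graph n) N E) * (2 * d * (n * M)\<^sup>2 + 1) ^ n\<^sup>2"
proof -
  define L where "L = int (n * M)"
  define X where "X = {..<d} \<rightarrow>\<^sub>E {-L..L}"
  define V where "V = {1..n} \<times> X"
  obtain c where c: "card (zero_sum_tuples n d L)
      \<le> card {p \<in> zero_sum_tuples n d L. \<forall>i\<in>{1..n}. \<forall>j\<in>{1..n}. dot d (p i) (p j) = c (i, j)}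
        * nat (2 * int d * L\<^sup>2 + 1) ^ n\<^sup>2"
    using popular_gram_matrix[of L n d] by (auto simp: L_def)
  define P where "P = {p \<in> zero_sum_tuples n d L. \<forall>i\<in>{1..n}. \<forall>j\<in>{1..n}. dot d (p i) (p j) = c (i, j)}"
  have "nat (2 * int d * L\<^sup>2 + 1) = 2 * d * (n * M)\<^sup>2 + 1"
  proof -
    have "2 * int d * L\<^sup>2 + 1 = int (2 * d * (n * M)\<^sup>2 + 1)" by (simp add: L_def)
    then show ?thesis by (simp only: nat_int)
  qed
  note R = this
  have "M ^ (d * (n - 1)) \<le> card (zero_sum_tuples n d L)"
    unfolding L_def using n by (intro card_zero_sum_tuples_ge) simp
  also note c[folded P_def, unfolded R]
  finally have P_card: "M ^ (d * (n - 1)) \<le> card P * (2 * d * (n * M)\<^sup>2 + 1) ^ n\<^sup>2" .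
  \<comment> \<open>A member of \<open>P\<close> realises \<open>c\<close> as a Gram matrix. This
    makes \<open>c\<close> symmetric and, as the vectors sum to zero, makes its entries sum to
    \<open>0\<close>.\<close>
  have "card P \<noteq> 0"
  proof
    assume "card P = 0"
    then have "M ^ (d * (n - 1)) \<le> 0" using P_card by simp
    then show False using M by simp
  qed
  then obtain p where p: "p \<in> P" by fastforce
  then have c_eq: "c (i, j) = dot d (p i) (p j)" if "i \<in> {1..n}" "j \<in> {1..n}" for i j
    using that by (simp add: P_def)
  have "(\<Sum>i\<in>{1..n}. \<Sum>j\<in>{1..n}. c (i, j)) = (\<Sum>k<d. (\<Sum>i\<in>{1..n}. p i k)\<^sup>2)"
    using sum_dot_eq[of d p "{1..n}"] by (simp add: c_eq)
  also have "\<dots> = 0"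
  proof (intro sum.neutral ballI)
    fix k assume "k \<in> {..<d}"
    then have "(\<Sum>i\<in>{1..n}. p i k) = 0"
      using p unfolding P_def zero_sum_tuples_def by blast
    then show "(\<Sum>i\<in>{1..n}. p i k)\<^sup>2 = 0" by simp
  qed
  finally have c0: "(\<Sum>i\<in>{1..n}. \<Sum>j\<in>{1..n}. c (i, j)) = 0" .
  have "card {-L..L} = 2 * (n * M) + 1" by (simp add: L_def nat_eq_iff algebra_simps)
  then have "card V = N" by (simp add: V_def X_def N card_PiE card_cartesian_product)
  moreover have "finite V" unfolding V_def X_def by (intro finite_cartesian_product finite_PiE) simp_all
  ultimately obtain b where b: "bij_betw b {..<N} V"
    using ex_bij_betw_nat_finite[of V] by (auto simp: atLeast0LessThan)
  define E where "E u v \<longleftrightarrow> gram_adj d c (b u) (b v)" for u v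
  have bV: "b u \<in> V" if "u < N" for u using b that by (auto simp: bij_betw_def)
  have c_sym: "c (i, j) = c (j, i)" if "i \<in> {1..n}" "j \<in> {1..n}" for i j
    using that by (simp add: c_eq dot_def mult.commute)
  have sym: "E v u" if "u < N" "v < N" "E u v" for u v
    using that(3) c_sym[of "fst (b u)" "fst (b v)"] bV[OF that(1)] bV[OF that(2)]
    by (auto simp: E_def gram_adj_def V_def dot_def mult.commute)
  have irrefl: "\<not> E u u" for u by (simp add: E_def gram_adj_def)
  have unique: "\<phi> i = \<psi> i" if \<phi>: "clique_map n E \<phi>" and \<psi>: "clique_map n E \<psi>"
    and \<phi>N: "\<phi> \<in> {1..n} \<rightarrow> {..<N}" and \<psi>N: "\<psi> \<in> {1..n} \<rightarrow> {..<N}"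
    and i: "i \<in> {1..n}" and eq: "\<And>j. j \<in> {1..n} - {i} \<Longrightarrow> \<phi> j = \<psi> j" for \<phi> \<psi> i
  proof -
    have "b (\<phi> i) = b (\<psi> i)"
    proof (rule gram_clique_unique[OF n c0, where \<phi> = "\<lambda>j. b (\<phi> j)" and \<psi> = "\<lambda>j. b (\<psi> j)"])
      show "clique_map n (gram_adj d c) (\<lambda>j. b (\<phi> j))" "clique_map n (gram_adj d c) (\<lambda>j. b (\<psi> j))"
        using \<phi> \<psi> by (simp_all add: clique_map_def E_def)
      show "b (\<phi> j) \<in> {1..n} \<times> ({..<d} \<rightarrow>\<^sub>E {-L..L})" "b (\<psi> j) \<in> {1..n} \<times> ({..<d} \<rightarrow>\<^sub>E {-L..L})"
        if "j \<in> {1..n}" for j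
        using bV[of "\<phi> j"] bV[of "\<psi> j"] funcset_mem[OF \<phi>N that] funcset_mem[OF \<psi>N that]
        by (simp_all add: V_def X_def)
    qed (use i eq in simp_all)
    then show ?thesis
      using inj_onD[OF bij_betw_imp_inj_on[OF b]] funcset_mem[OF \<phi>N i] funcset_mem[OF \<psi>N i] by blast
  qed
  have "facets_determine_cliques n N E"
    unfolding facets_determine_cliques_def using unique by blast
  moreover have "M ^ (d * (n - 1)) \<le> card (homs (complete_graph n) N E) * (2 * d * (n * M)\<^sup>2 + 1) ^ n\<^sup>2"
  proof -
    define g where "g = inv_into {..<N} b"
    have g: "g v < N" "b (g v) = v" if "v \<in> V" for v
    proof -
      have "v \<in> b ` {..<N}" using b that by (simp add: bij_betw_def)
      then show "g v < N" "b (g v) = v"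
        unfolding g_def using inv_into_into[of v b "{..<N}"] by (simp_all add: f_inv_into_f)
    qed
    have pV: "(i, q i) \<in> V" if "q \<in> P" "i \<in> {1..n}" for q i
      using that unfolding P_def zero_sum_tuples_def V_def X_def by auto
    \<comment> \<open>A tuple of \<open>P\<close> becomes a clique by placing its
      \<open>i\<close>-th vector in the \<open>i\<close>-th part, and applying \<open>b\<close>
      recovers the tuple.\<close>
    have "card P \<le> card (homs (complete_graph n) N E)"
    proof (rule card_inj_on_le)
      show "inj_on (\<lambda>q. \<lambda>i\<in>{1..n}. g (i, q i)) P"
      proof (rule inj_onI)
        fix q r assume qr: "q \<in> P" "r \<in> P" "(\<lambda>i\<in>{1..n}. g (i, q i)) = (\<lambda>i\<in>{1..n}. g (i, r i))"
        have "q i = r i" if "i \<in> {1..n}" for i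
        proof -
          have "g (i, q i) = g (i, r i)" using fun_cong[OF qr(3), of i] that by simp
          then have "b (g (i, q i)) = b (g (i, r i))" by (rule arg_cong)
          then show ?thesis unfolding g(2)[OF pV[OF qr(1) that]] g(2)[OF pV[OF qr(2) that]] by simp
        qed
        note eq = this
        have "q \<in> {1..n} \<rightarrow>\<^sub>E X" "r \<in> {1..n} \<rightarrow>\<^sub>E X"
          using qr unfolding P_def zero_sum_tuples_def X_def by blast+
        then show "q = r" by (rule PiE_ext[OF _ _ eq])
      qed
      show "(\<lambda>q. \<lambda>i\<in>{1..n}. g (i, q i)) ` P \<subseteq> homs (complete_graph n) N E"
      proof (rule image_subsetI)
        fix q assume q: "q \<in> P"
        have "clique_map n E (\<lambda>i\<in>{1..n}. g (i, q i))"
          unfolding clique_map_def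
        proof (intro ballI impI)
          fix i j assume ij: "i \<in> {1..n}" "j \<in> {1..n}" "i \<noteq> j"
          have dot: "dot d (q k) (q l) = c (k, l)" if "k \<in> {1..n}" "l \<in> {1..n}" for k l
            using q that unfolding P_def by blast
          have "E (g (i, q i)) (g (j, q j))"
            unfolding E_def g(2)[OF pV[OF q ij(1)]] g(2)[OF pV[OF q ij(2)]] gram_adj_def fst_conv snd_conv
            using ij dot by blast
          then show "E ((\<lambda>i\<in>{1..n}. g (i, q i)) i) ((\<lambda>i\<in>{1..n}. g (i, q i)) j)"
            using ij by (simp only: restrict_apply if_True)
        qed
        then show "(\<lambda>i\<in>{1..n}. g (i, q i)) \<in> homs (complete_graph n) N E"
          unfolding homs_complete_graph using g(1)[OF pV[OF q]]
          by (intro CollectI conjI) (simp_all only: restrict_PiE_iff lessThan_iff, blast)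
      qed
      show "finite (homs (complete_graph n) N E)"
        by (rule finite_homs) (simp add: complete_graph_def)
    qed
    then show ?thesis
      using P_card by (meson le_trans mult_le_mono1)
  qed
  ultimately show ?thesis using sym irrefl by blast
qed

text \<open>Exchanging \<open>Central i\<close> for its twin \<open>Outer i k\<close> yields a
  clique map that agrees with the original off \<open>i\<close>, so both vertices have the same
  image. A homomorphism is thus determined by its restriction to the central clique.\<close>

lemma card_homs_K'_le:
  assumes "facets_determine_cliques n N E"
  shows "card (homs (K' n a) N E) \<le> card (homs (complete_graph n) N E)"
proof (rule card_inj_on_le)
  let ?r = "\<lambda>\<theta>. \<lambda>i\<in>{1..n}. \<theta> (Central i)"
  have verts: "\<theta> (Central i) < N" if "\<theta> \<in> homs (K' n a) N E" "i \<in> {1..n}" for \<theta> i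
  proof -
    have "Central i \<in> verts (K' n a)" using that by (simp add: K'_def)
    then show ?thesis using that(1) unfolding homs_def by blast
  qed
  have edge: "E (\<theta> u) (\<theta> v)" if "\<theta> \<in> homs (K' n a) N E" "{u, v} \<in> edges (K' n a)" for \<theta> u v
    using that by (simp add: homs_def)
  have central: "{Central i, Central j} \<in> edges (K' n a)" if "i \<in> {1..n}" "j \<in> {1..n}" "i \<noteq> j" for i j
    using that unfolding K'_def graph.simps by blast
  have outer: "{Outer i k, Central j} \<in> edges (K' n a)"
    if "i \<in> {1..n}" "k \<in> {1..a i}" "j \<in> {1..n}" "j \<noteq> i" for i j k
    using that unfolding K'_def graph.simps by blast
  have clique: "clique_map n E (\<lambda>i. \<theta> (Central i))" if "\<theta> \<in> homs (K' n a) N E" for \<theta>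
    unfolding clique_map_def using edge[OF that central] by blast
  have \<theta>_outer: "\<theta> (Central i) = \<theta> (Outer i k)"
    if \<theta>: "\<theta> \<in> homs (K' n a) N E" and i: "i \<in> {1..n}" and k: "k \<in> {1..a i}" for \<theta> i k
  proof -
    define \<psi> where "\<psi> = (\<lambda>i. \<theta> (Central i))(i := \<theta> (Outer i k))"
    have "Outer i k \<in> verts (K' n a)" using i k by (simp add: K'_def)
    then have "\<theta> (Outer i k) < N" using \<theta> unfolding homs_def by blast
    then have \<psi>N: "\<psi> \<in> {1..n} \<rightarrow> {..<N}"
      using verts[OF \<theta>] by (auto simp: \<psi>_def)
    have "clique_map n E \<psi>"
      unfolding clique_map_def
    proof (intro ballI impI)
      fix j l assume jl: "j \<in> {1..n}" "l \<in> {1..n}" "j \<noteq> l"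
      consider "j = i" | "l = i" | "j \<noteq> i" "l \<noteq> i" by blast
      then show "E (\<psi> j) (\<psi> l)"
      proof cases
        case 1
        then show ?thesis using edge[OF \<theta> outer[OF i k jl(2)]] jl by (simp add: \<psi>_def)
      next
        case 2
        then have "{Central j, Outer i k} \<in> edges (K' n a)"
          using outer[OF i k jl(1)] jl by (simp add: insert_commute)
        then show ?thesis using 2 edge[OF \<theta>] jl by (simp add: \<psi>_def)
      next
        case 3
        then show ?thesis using edge[OF \<theta> central[OF jl]] by (simp add: \<psi>_def)
      qed
    qed
    moreover have "(\<lambda>i. \<theta> (Central i)) \<in> {1..n} \<rightarrow> {..<N}"
      using verts[OF \<theta>] by blast
    moreover have "\<theta> (Central j) = \<psi> j" if "j \<in> {1..n} - {i}" for j
      using that by (simp add: \<psi>_def)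
    ultimately have "\<theta> (Central i) = \<psi> i"
      using assms[unfolded facets_determine_cliques_def, rule_format, of i "\<lambda>i. \<theta> (Central i)" \<psi>]
        i clique[OF \<theta>] \<psi>N by blast
    then show ?thesis by (simp add: \<psi>_def)
  qed
  show "inj_on ?r (homs (K' n a) N E)"
  proof (rule inj_onI)
    fix \<theta> \<eta> assume *: "\<theta> \<in> homs (K' n a) N E" "\<eta> \<in> homs (K' n a) N E" "?r \<theta> = ?r \<eta>"
    have eq: "\<theta> (Central i) = \<eta> (Central i)" if "i \<in> {1..n}" for i
      using fun_cong[OF *(3), of i] that by simp
    have "\<theta> v = \<eta> v" if "v \<in> verts (K' n a)" for v
    proof -
      have "(\<exists>i\<in>{1..n}. v = Central i) \<or> (\<exists>i\<in>{1..n}. \<exists>k\<in>{1..a i}. v = Outer i k)"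
        using that unfolding K'_def graph.simps by blast
      then show ?thesis
        using eq \<theta>_outer[OF *(1)] \<theta>_outer[OF *(2)] by metis
    qed
    note eqv = this
    have "\<theta> \<in> verts (K' n a) \<rightarrow>\<^sub>E {..<N}" "\<eta> \<in> verts (K' n a) \<rightarrow>\<^sub>E {..<N}"
      using * by (simp_all add: homs_def)
    then show "\<theta> = \<eta>" by (rule PiE_ext[OF _ _ eqv])
  qed
  show "?r ` homs (K' n a) N E \<subseteq> homs (complete_graph n) N E"
  proof (rule image_subsetI)
    fix \<theta> assume "\<theta> \<in> homs (K' n a) N E"
    then show "?r \<theta> \<in> homs (complete_graph n) N E"
      using clique[of \<theta>] verts[of \<theta>] by (auto simp: homs_complete_graph clique_map_def)
  qed
  show "finite (homs (complete_graph n) N E)"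
    by (rule finite_homs) (simp add: complete_graph_def)
qed

section \<open>Step graphons\<close>

text \<open>Cuts the unit interval into \<open>N\<close> intervals of length \<open>1 / N\<close>;
  the \<open>min\<close> puts the endpoint \<open>1\<close> into the last of them.\<close>

definition cell :: "nat \<Rightarrow> real \<Rightarrow> nat" where
  "cell N x = min (N - 1) (nat \<lfloor>real N * x\<rfloor>)"

definition step_graphon :: "nat \<Rightarrow> (nat \<Rightarrow> nat \<Rightarrow> bool) \<Rightarrow> real \<Rightarrow> real \<Rightarrow> real" where
  "step_graphon N E x y = of_bool (E (cell N x) (cell N y))"

lemma cell_less: "N > 0 \<Longrightarrow> cell N x < N"
  by (auto simp: cell_def)

lemma cell_vimage:
  assumes "k < N"
  shows "{x \<in> {0..1}. cell N x = k}
    = (if k = N - 1 then {real k / real N..1} else {real k / real N..<real (Suc k) / real N})"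
proof -
  have iff: "cell N x = k \<longleftrightarrow> real k \<le> real N * x \<and> (k = N - 1 \<or> real N * x < real (Suc k))" if "0 \<le> x" for x
  proof -
    have "nat \<lfloor>real N * x\<rfloor> = m \<longleftrightarrow> real m \<le> real N * x \<and> real N * x < real m + 1" for m
      using that by (metis floor_eq_iff nat_eq_iff2 of_int_of_nat_eq of_nat_0_le_iff zero_le_floor zero_le_mult_iff)
    moreover have "N - 1 \<le> nat \<lfloor>real N * x\<rfloor> \<longleftrightarrow> real (N - 1) \<le> real N * x"
      using that by (simp add: le_nat_floor le_nat_iff le_floor_iff)
    moreover have "cell N x = k \<longleftrightarrow> (if k = N - 1 then N - 1 \<le> nat \<lfloor>real N * x\<rfloor> else nat \<lfloor>real N * x\<rfloor> = k)"
      using assms by (auto simp: cell_def min_def)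
    ultimately show ?thesis by (simp add: add.commute)
  qed
  show ?thesis
  proof (rule set_eqI)
    fix x :: real
    have bounds: "real (Suc k) / real N \<le> 1" "0 \<le> real k / real N" using assms by simp_all
    have "real k \<le> real N * x \<longleftrightarrow> real k / real N \<le> x" "real N * x < real (Suc k) \<longleftrightarrow> x < real (Suc k) / real N"
      using assms by (simp_all add: field_simps)
    with bounds show "x \<in> {x \<in> {0..1}. cell N x = k} \<longleftrightarrow>
        x \<in> (if k = N - 1 then {real k / real N..1} else {real k / real N..<real (Suc k) / real N})"
    proof (cases "0 \<le> x")
      case False
      then have "\<not> real k / real N \<le> x" using bounds by linarith
      with False show ?thesis by auto
    qed (use iff[of x] in \<open>simp del: of_nat_Suc, linarith\<close>)
  qed
qed

lemma emeasure_cell: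
  assumes "k < N"
  shows "{x \<in> {0..1}. cell N x = k} \<in> sets unit_measure"
    and "emeasure unit_measure {x \<in> {0..1}. cell N x = k} = ennreal (1 / real N)"
proof -
  have "{x \<in> {0..1}. cell N x = k} \<in> sets lborel"
    unfolding cell_vimage[OF assms] by simp
  then show "{x \<in> {0..1}. cell N x = k} \<in> sets unit_measure"
    by (auto simp: sets_restrict_space_iff)
  have "emeasure lborel {x \<in> {0..1}. cell N x = k} = ennreal (1 / real N)"
    unfolding cell_vimage[OF assms] using assms
    by (auto simp: field_simps of_nat_diff intro!: arg_cong[where f = ennreal])
  then show "emeasure unit_measure {x \<in> {0..1}. cell N x = k} = ennreal (1 / real N)"
    by (subst emeasure_restrict_space) auto
qed

text \<open>The function factors through pairs of cells, a countable discrete space on which every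
  predicate is measurable.\<close>

lemma graphon_step_graphon:
  assumes "N > 0" "\<And>i j. i < N \<Longrightarrow> j < N \<Longrightarrow> E i j \<Longrightarrow> E j i"
  shows "graphon (step_graphon N E)"
proof -
  have "cell N \<in> measurable borel (count_space UNIV)"
    unfolding cell_def by measurable
  then have "(\<lambda>p. (cell N (fst p), cell N (snd p))) \<in> measurable (borel \<Otimes>\<^sub>M borel) (count_space UNIV \<Otimes>\<^sub>M count_space UNIV)"
    by measurable
  then have "(\<lambda>p. (cell N (fst p), cell N (snd p))) \<in> measurable borel (count_space UNIV)"
    by (simp add: borel_prod pair_measure_countable)
  then have "(\<lambda>p. of_bool (E (fst (cell N (fst p), cell N (snd p))) (snd (cell N (fst p), cell N (snd p)))) :: real) \<in> borel_measurable borel"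
    by (rule measurable_compose) simp
  then have "case_prod (step_graphon N E) \<in> borel_measurable borel"
    by (simp add: step_graphon_def case_prod_beta')
  moreover have "E (cell N x) (cell N y) \<longleftrightarrow> E (cell N y) (cell N x)" for x y
    using assms(2) cell_less[OF assms(1)] by blast
  ultimately show ?thesis
    unfolding graphon_def by (auto simp: step_graphon_def intro: measurable_restrict_space1)
qed

text \<open>Each point lies in the product of cells given by exactly one map \<open>\<psi>\<close>,
  and the product of edge weights is \<open>1\<close> or \<open>0\<close> according to whether
  \<open>\<psi>\<close> is a homomorphism. Each such product of cells has volume
  \<open>(1 / N) ^ card (verts G)\<close>.\<close>

lemma hom_density_step_graphon:
  assumes N: "N > 0" and E: "\<And>i j. i < N \<Longrightarrow> j < N \<Longrightarrow> E i j \<Longrightarrow> E j i" and G: "simple_graph G"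
  shows "hom_density G (step_graphon N E) = real (card (homs G N E)) / real N ^ card (verts G)"
proof -
  let ?W = "step_graphon N E"
  let ?M = "PiM (verts G) (\<lambda>_. unit_measure)"
  interpret product_prob_space "\<lambda>_. unit_measure" "verts G"
    by (rule product_prob_space_unit_measure)
  interpret finite_product_sigma_finite "\<lambda>_. unit_measure" "verts G"
    using G by unfold_locales (simp add: simple_graph_def)
  note W = graphon_step_graphon[OF N E]
  define B where "B \<phi> = PiE (verts G) (\<lambda>v. {x \<in> {0..1}. cell N x = \<phi> v})" for \<phi> :: "'a \<Rightarrow> nat"
  have fin: "finite (verts G)" "finite (edges G)"
    using G by (auto simp: simple_graph_def intro: finite_subset[of _ "Pow (verts G)"])
  then have fin_homs: "finite (homs G N E)"
    by (intro finite_homs)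
  have B: "B \<phi> \<in> sets ?M" "emeasure ?M (B \<phi>) = ennreal ((1 / real N) ^ card (verts G))"
    if "\<phi> \<in> homs G N E" for \<phi>
  proof -
    have \<phi>: "\<phi> v < N" if "v \<in> verts G" for v
      using \<open>\<phi> \<in> homs G N E\<close> that by (auto simp: homs_def)
    show "B \<phi> \<in> sets ?M"
      unfolding B_def using emeasure_cell(1)[OF \<phi>] fin by (intro sets_PiM_I_finite) auto
    have "emeasure ?M (B \<phi>) = (\<Prod>v\<in>verts G. emeasure unit_measure {x \<in> {0..1}. cell N x = \<phi> v})"
      unfolding B_def using emeasure_cell(1)[OF \<phi>] by (intro measure_times) auto
    also have "\<dots> = (\<Prod>v\<in>verts G. ennreal (1 / real N))"
      by (intro prod.cong refl emeasure_cell(2) \<phi>)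
    finally show "emeasure ?M (B \<phi>) = ennreal ((1 / real N) ^ card (verts G))"
      by (simp add: ennreal_power)
  qed
  have pointwise: "(\<Prod>e\<in>edges G. ennreal (edge_weight ?W x e)) = (\<Sum>\<phi>\<in>homs G N E. indicator (B \<phi>) x)"
    if x: "x \<in> space ?M" for x
  proof -
    define \<psi> where "\<psi> = (\<lambda>v\<in>verts G. cell N (x v))"
    have mem: "x \<in> B \<phi> \<longleftrightarrow> \<phi> = \<psi>" if "\<phi> \<in> homs G N E" for \<phi>
    proof -
      have "x \<in> B \<phi> \<longleftrightarrow> (\<forall>v\<in>verts G. \<phi> v = cell N (x v))"
        using x unfolding B_def by (auto simp: space_PiM space_unit_measure PiE_iff)
      also have "\<dots> \<longleftrightarrow> \<phi> = \<psi>"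
        using that by (auto simp: homs_def \<psi>_def PiE_def extensional_def fun_eq_iff)
      finally show ?thesis .
    qed
    have ew: "edge_weight ?W x {u, v} = of_bool (E (\<psi> u) (\<psi> v))" if "u \<in> verts G" "v \<in> verts G" for u v
      using unit_PiM_mem[OF x] that by (simp add: edge_weight_doubleton[OF W] step_graphon_def \<psi>_def)
    have "(\<Sum>\<phi>\<in>homs G N E. indicator (B \<phi>) x :: ennreal) = (\<Sum>\<phi>\<in>homs G N E. if \<phi> = \<psi> then 1 else 0)"
      by (intro sum.cong) (auto simp: mem indicator_def)
    also have "\<dots> = of_bool (\<psi> \<in> homs G N E)"
      using fin_homs by simp
    also have "\<dots> = (\<Prod>e\<in>edges G. ennreal (edge_weight ?W x e))"
    proof (cases "\<psi> \<in> homs G N E")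
      case True
      have "ennreal (edge_weight ?W x e) = 1" if e: "e \<in> edges G" for e
      proof -
        have "e \<subseteq> verts G" "card e = 2" using G e by (auto simp: simple_graph_def)
        then obtain u v where "e = {u, v}" "u \<in> verts G" "v \<in> verts G"
          by (auto simp: card_2_iff)
        then show ?thesis using True e ew by (simp add: homs_def)
      qed
      then show ?thesis using True by simp
    next
      case False
      have "\<psi> \<in> verts G \<rightarrow>\<^sub>E {..<N}" using cell_less[OF N] by (simp add: \<psi>_def)
      then obtain u v where uv: "{u, v} \<in> edges G" "\<not> E (\<psi> u) (\<psi> v)"
        using False by (auto simp: homs_def)
      then have "ennreal (edge_weight ?W x {u, v}) = 0"
        using G ew[of u v] by (auto simp: simple_graph_def)
      then show ?thesis using False uv fin by (auto intro: prod_zero)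
    qed
    finally show ?thesis by simp
  qed
  have "ennreal (hom_density G ?W) = (\<integral>\<^sup>+x. (\<Prod>e\<in>edges G. ennreal (edge_weight ?W x e)) \<partial>?M)"
    by (rule ennreal_hom_density[OF W G])
  also have "\<dots> = (\<integral>\<^sup>+x. (\<Sum>\<phi>\<in>homs G N E. indicator (B \<phi>) x) \<partial>?M)"
    by (intro nn_integral_cong pointwise)
  also have "\<dots> = (\<Sum>\<phi>\<in>homs G N E. emeasure ?M (B \<phi>))"
    using B(1) by (subst nn_integral_sum) auto
  also have "\<dots> = ennreal (real (card (homs G N E)) / real N ^ card (verts G))"
    by (simp add: B(2) power_divide ennreal_of_nat_eq_real_of_nat flip: ennreal_mult'')
  finally show ?thesis
    by (subst (asm) ennreal_inj) (auto simp: hom_density_nonneg[OF W G])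
qed

section \<open>The density domination exponent\<close>

text \<open>With \<open>M = 2 ^ d\<close>, the order \<open>N\<close> is \<open>2\<close> to the
  power \<open>d * d\<close> up to a term linear in \<open>d\<close>, and the pigeonhole loss is
  only \<open>2\<close> to a linear power. Hence the clique density \<open>h / N ^ n\<close> is at
  least \<open>2 ^ -(d * d + C * d)\<close>, with \<open>C\<close> depending on \<open>n\<close>
  alone.\<close>

lemma facets_determine_cliques_graph_bound:
  fixes n d :: nat
  defines "C \<equiv> 7 * n\<^sup>2 + 2 * n ^ 3 + 2 * n"
  assumes n: "n \<ge> 1" and d: "d \<ge> 1"
    and N: "N = n * (2 * (n * 2 ^ d) + 1) ^ d"
    and h: "(2 ^ d) ^ (d * (n - 1)) \<le> h * (2 * d * (n * 2 ^ d)\<^sup>2 + 1) ^ n\<^sup>2"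
  shows "2 ^ (d * d) \<le> N" and "N ^ n \<le> h * 2 ^ (d * d + C * d)"
proof -
  \<comment> \<open>Replaces the factors \<open>n\<close> and \<open>d\<close> by powers of two, so
    that only exponents remain to be compared.\<close>
  have le2: "k \<le> 2 ^ k" for k :: nat using less_exp[of k] by simp
  have "2 ^ d \<le> n * 2 ^ d" using n by simp
  then have "2 ^ d \<le> 2 * (n * 2 ^ d) + 1" by linarith
  then have "(2 ^ d) ^ d \<le> (2 * (n * 2 ^ d) + 1) ^ d" by (rule power_mono) simp
  also have "\<dots> \<le> N" unfolding N using n by simp
  finally show "2 ^ (d * d) \<le> N" by (simp add: power_mult)
  have "2 * (n * 2 ^ d) + 1 \<le> 4 * (n * 2 ^ d)" using n by (simp add: Suc_le_eq)
  also have "\<dots> \<le> 4 * (2 ^ n * 2 ^ d)" using le2 by (intro mult_le_mono) auto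
  also have "\<dots> = 2 ^ (2 + n + d)" by (simp add: power_add)
  finally have "N \<le> 2 ^ n * (2 ^ (2 + n + d)) ^ d"
    unfolding N using le2 by (intro mult_le_mono power_mono) auto
  also have "\<dots> = 2 ^ (n + (2 + n + d) * d)" by (simp only: power_add power_mult)
  finally have "N ^ n \<le> (2 ^ (n + (2 + n + d) * d)) ^ n" by (rule power_mono) simp
  then have Nn: "N ^ n \<le> 2 ^ ((n + (2 + n + d) * d) * n)" by (simp only: power_mult)
  have "1 \<le> d * (n * 2 ^ d)\<^sup>2" using n d by simp
  then have "2 * d * (n * 2 ^ d)\<^sup>2 + 1 \<le> 4 * (d * (n * 2 ^ d)\<^sup>2)" by linarith
  also have "\<dots> \<le> 4 * (2 ^ d * (2 ^ n * 2 ^ d)\<^sup>2)"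
    using le2 by (intro mult_le_mono power_mono) auto
  also have "\<dots> = 2\<^sup>2 * (2 ^ d * (2 ^ (n + d))\<^sup>2)" by (simp add: power_add)
  also have "\<dots> = 2 ^ (2 + d + (n + d) * 2)" by (simp only: power_add power_mult mult.assoc)
  finally have "(2 * d * (n * 2 ^ d)\<^sup>2 + 1) ^ n\<^sup>2 \<le> (2 ^ (2 + d + (n + d) * 2)) ^ n\<^sup>2"
    by (rule power_mono) simp
  then have R: "(2 * d * (n * 2 ^ d)\<^sup>2 + 1) ^ n\<^sup>2 \<le> 2 ^ ((2 + d + (n + d) * 2) * n\<^sup>2)" by (simp only: power_mult)
  \<comment> \<open>Origin of \<open>C\<close>: beyond \<open>n * (d * d)\<close>, the left side has
    the linear term \<open>(4 * n\<^sup>2 + 2 * n) * d\<close> and the constant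
    \<open>3 * n\<^sup>2 + 2 * n ^ 3\<close>, which is at most \<open>d\<close> times itself as
    \<open>d \<ge> 1\<close>.\<close>
  have expo: "(n + (2 + n + d) * d) * n + (2 + d + (n + d) * 2) * n\<^sup>2 \<le> (d * d + C * d) + d * (d * (n - 1))"
  proof -
    have "(n + (2 + n + d) * d) * n + (2 + d + (n + d) * 2) * n\<^sup>2 \<le> n * (d * d) + C * d"
      using d unfolding C_def by (cases d) (simp_all add: algebra_simps power2_eq_square power3_eq_cube)
    moreover have "d * d + d * (d * (n - 1)) = n * (d * d)"
      using n by (cases n) (simp_all add: algebra_simps)
    ultimately show ?thesis by linarith
  qed
  have "N ^ n * 2 ^ (d * (d * (n - 1))) \<le> N ^ n * (h * (2 * d * (n * 2 ^ d)\<^sup>2 + 1) ^ n\<^sup>2)"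
    using h by (simp only: power_mult mult_le_mono2)
  also have "\<dots> \<le> 2 ^ ((n + (2 + n + d) * d) * n) * (h * 2 ^ ((2 + d + (n + d) * 2) * n\<^sup>2))"
    by (intro mult_le_mono Nn R order_refl)
  also have "\<dots> = h * 2 ^ ((n + (2 + n + d) * d) * n + (2 + d + (n + d) * 2) * n\<^sup>2)"
    by (simp only: power_add mult_ac)
  also have "\<dots> \<le> h * 2 ^ ((d * d + C * d) + d * (d * (n - 1)))"
    by (intro mult_le_mono2 power_increasing expo) simp
  also have "\<dots> = (h * 2 ^ (d * d + C * d)) * 2 ^ (d * (d * (n - 1)))"
    by (simp only: power_add mult.assoc)
  finally show "N ^ n \<le> h * 2 ^ (d * d + C * d)"
    by (simp only: mult_le_cancel2) simp
qed

lemma card_verts_K': "card (verts (K' n a)) = n + (\<Sum>i=1..n. a i)"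
proof -
  let ?Q = "(\<lambda>(i, k). Outer i k) ` Sigma {1..n} (\<lambda>i. {1..a i})"
  have "verts (K' n a) = Central ` {1..n} \<union> ?Q"
    by (auto simp: K'_def)
  moreover have "card (Central ` {1..n}) = n"
    by (subst card_image) (auto simp: inj_on_def)
  moreover have "card ?Q = (\<Sum>i=1..n. a i)"
    by (subst card_image) (auto simp: inj_on_def)
  moreover have "card (Central ` {1..n} \<union> ?Q) = card (Central ` {1..n}) + card ?Q"
    by (rule card_Un_disjoint) auto
  ultimately show ?thesis by (simp only:)
qed

section \<open>Upper bound and sharpness for the exponent\<close>

lemma density_domination_exponent_K'_le:
  assumes n: "n \<ge> 2"
  shows "density_domination_exponent (complete_graph n) (K' n a) \<le> ereal (1 + real (\<Sum>i=1..n. a i))"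
  unfolding density_domination_exponent_def
proof (intro Sup_least)
  fix q assume "q \<in> insert 0 {ext_ln (hom_density (K' n a) W) / ext_ln (hom_density (complete_graph n) W) | W.
                      graphon W \<and> hom_density (complete_graph n) W \<noteq> 0 \<and> hom_density (complete_graph n) W \<noteq> 1}"
  then consider "q = 0" | W where "graphon W" "hom_density (complete_graph n) W \<noteq> 0" "hom_density (complete_graph n) W \<noteq> 1"
      "q = ext_ln (hom_density (K' n a) W) / ext_ln (hom_density (complete_graph n) W)" by blast
  then show "q \<le> ereal (1 + real (\<Sum>i=1..n. a i))"
  proof cases
    case 2
    let ?t = "hom_density (complete_graph n) W" and ?s = "hom_density (K' n a) W" and ?A = "\<Sum>i=1..n. a i"
    have t: "0 < ?t" "?t < 1"
      using 2 hom_density_nonneg[OF _ simple_graph_complete_graph, of W n]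
        hom_density_le_1[OF _ simple_graph_complete_graph, of W n] by simp_all
    have le: "?t ^ Suc ?A \<le> ?s" by (rule hom_density_K'_ge[OF 2(1)])
    moreover have "0 < ?t ^ Suc ?A" using t by simp
    ultimately have s: "0 < ?s" by linarith
    have "ln (?t ^ Suc ?A) \<le> ln ?s" using le t by (intro ln_mono) simp_all
    then have "real (Suc ?A) * ln ?t \<le> ln ?s" using t by (simp only: ln_realpow)
    moreover have "ln ?t < 0" using t by simp
    ultimately have "ln ?s / ln ?t \<le> real (Suc ?A)" by (simp only: neg_divide_le_eq)
    then show ?thesis using 2 t s by (simp add: ext_ln_def)
  qed (simp add: add_nonneg_nonneg sum_nonneg)
qed

text \<open>On the step graphon, \<open>K'\<close> has at most as many homomorphisms as the clique
  but \<open>A\<close> more vertices, so its density \<open>s\<close> is at most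
  \<open>t / N ^ A\<close> and \<open>ln s / ln t \<ge> 1 + A * ln N / (- ln t)\<close>. The last
  quotient is at least \<open>d / (C + d)\<close>, which tends to \<open>1\<close>.\<close>

lemma density_domination_exponent_K'_ge:
  assumes n: "n \<ge> 2"
  shows "ereal (1 + real (\<Sum>i=1..n. a i)) \<le> density_domination_exponent (complete_graph n) (K' n a)"
proof -
  define A where "A = (\<Sum>i=1..n. a i)"
  define C where "C = 7 * n\<^sup>2 + 2 * n ^ 3 + 2 * n"
  let ?\<rho> = "density_domination_exponent (complete_graph n) (K' n a)"
  have bound: "ereal (1 + real A * (1 - real C / (real C + real d))) \<le> ?\<rho>" if d: "d \<ge> 1" for d
  proof -
    define N where "N = n * (2 * (n * 2 ^ d) + 1) ^ d"
    have "(2::nat) ^ d \<ge> 1" by simp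
    from facets_determine_cliques_graph[OF n this N_def] obtain E
      where sym: "\<And>u v. u < N \<Longrightarrow> v < N \<Longrightarrow> E u v \<Longrightarrow> E v u" and irrefl: "\<And>u. \<not> E u u"
        and unique: "facets_determine_cliques n N E"
        and count: "(2 ^ d) ^ (d * (n - 1)) \<le> card (homs (complete_graph n) N E) * (2 * d * (n * 2 ^ d)\<^sup>2 + 1) ^ n\<^sup>2"
      by blast
    define h where "h = card (homs (complete_graph n) N E)"
    have N_ge: "2 ^ (d * d) \<le> N" and Nn_le: "N ^ n \<le> h * 2 ^ (d * d + C * d)"
      using facets_determine_cliques_graph_bound[OF _ d N_def count] n by (simp_all add: h_def C_def)
    have "N > 0" using N_ge by (cases N) simp_all
    then have "h > 0" using Nn_le by (cases h) simp_all
    define W where "W = step_graphon N E"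
    have W: "graphon W" unfolding W_def by (rule graphon_step_graphon[OF \<open>N > 0\<close> sym])
    have "card (verts (complete_graph n)) = n" by (simp add: complete_graph_def)
    then have t: "hom_density (complete_graph n) W = real h / real N ^ n"
      using hom_density_step_graphon[where E = E, OF \<open>N > 0\<close> sym simple_graph_complete_graph[of n]]
      by (simp only: W_def h_def)
    have s: "hom_density (K' n a) W = real (card (homs (K' n a) N E)) / real N ^ (n + A)"
      using hom_density_step_graphon[where E = E, OF \<open>N > 0\<close> sym simple_graph_K'[of n a]]
      by (simp only: W_def A_def card_verts_K')
    let ?t = "hom_density (complete_graph n) W" and ?s = "hom_density (K' n a) W"
    \<comment> \<open>Needed for \<open>?t < 1\<close>, so that \<open>W\<close> is admissible: a
      constant map is no clique because \<open>E\<close> is irreflexive.\<close>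
    have "h < card ({1..n} \<rightarrow>\<^sub>E {..<N})"
      unfolding h_def
    proof (rule psubset_card_mono)
      have "(\<lambda>i\<in>{1..n}. 0) \<in> {1..n} \<rightarrow>\<^sub>E {..<N}" using \<open>N > 0\<close> by simp
      moreover have "\<not> clique_map n E (\<lambda>i\<in>{1..n}. 0)"
      proof
        assume "clique_map n E (\<lambda>i\<in>{1..n}. 0)"
        moreover have "1 \<in> {1..n}" "2 \<in> {1..n}" "(1::nat) \<noteq> 2" using n by simp_all
        ultimately have "E ((\<lambda>i\<in>{1..n}. 0) 1) ((\<lambda>i\<in>{1..n}. 0) 2)"
          unfolding clique_map_def by blast
        then show False using irrefl n by simp
      qed
      ultimately show "homs (complete_graph n) N E \<subset> {1..n} \<rightarrow>\<^sub>E {..<N}"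
        unfolding homs_complete_graph by blast
    qed (intro finite_PiE finite_lessThan finite_atLeastAtMost)
    then have "real h < real (N ^ n)" by (simp add: card_PiE)
    then have t1: "0 < ?t" "?t < 1" using \<open>h > 0\<close> \<open>N > 0\<close> by (simp_all add: t)
    then have lnt: "ln ?t < 0" by simp
    \<comment> \<open>The inequality behind the upper bound is reused to keep
      \<open>ext_ln ?s\<close> finite.\<close>
    have s0: "0 < ?s"
      using hom_density_K'_ge[OF W, of n a] t1 by (meson less_le_trans zero_less_power)
    have "real (card (homs (K' n a) N E)) \<le> real h"
      unfolding h_def using card_homs_K'_le[OF unique] by simp
    then have "?s \<le> real h / real N ^ (n + A)"
      unfolding s by (rule divide_right_mono) simp
    then have "?s \<le> ?t / real N ^ A" by (simp add: t power_add)
    then have "ln ?s \<le> ln (?t / real N ^ A)" using s0 t1 \<open>N > 0\<close> by (intro ln_mono) simp_all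
    also have "\<dots> = ln ?t - real A * ln (real N)"
      using t1 \<open>N > 0\<close> by (simp add: ln_div ln_realpow)
    finally have "(ln ?t - real A * ln (real N)) / ln ?t \<le> ln ?s / ln ?t"
      using lnt by (intro divide_right_mono_neg) simp_all
    then have 1: "1 + real A * (ln (real N) / (- ln ?t)) \<le> ln ?s / ln ?t"
      using lnt by (simp add: diff_divide_distrib)
    have "real (2 ^ (d * d)) \<le> real N" using N_ge by (simp only: of_nat_le_iff)
    then have "ln (2 ^ (d * d)) \<le> ln (real N)" by (intro ln_mono) simp_all
    then have lnN: "real (d * d) * ln 2 \<le> ln (real N)" by (simp only: ln_realpow)
    have "real (N ^ n) \<le> real (h * 2 ^ (d * d + C * d))" using Nn_le by (simp only: of_nat_le_iff)
    then have "1 / 2 ^ (d * d + C * d) \<le> ?t" using \<open>N > 0\<close> by (simp add: t field_simps)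
    then have "ln (1 / 2 ^ (d * d + C * d)) \<le> ln ?t" by (intro ln_mono) simp_all
    then have lnt': "- ln ?t \<le> real (d * d + C * d) * ln 2" by (simp add: ln_div ln_realpow)
    \<comment> \<open>Expanding the fraction by \<open>d * ln 2\<close> exhibits the lower bound for
      \<open>ln N\<close> over the upper bound for \<open>- ln ?t\<close>.\<close>
    have "1 - real C / (real C + real d) = real d / (real C + real d)"
      using d by (simp add: field_simps)
    also have "\<dots> = (real d * ln 2) * real d / ((real d * ln 2) * (real C + real d))"
      using d by (intro mult_divide_mult_cancel_left[symmetric]) simp
    also have "\<dots> = real (d * d) * ln 2 / (real (d * d + C * d) * ln 2)"
      by (simp add: algebra_simps)
    also have "\<dots> \<le> ln (real N) / (- ln ?t)"
      using lnN lnt' lnt \<open>N > 0\<close> by (intro frac_le) simp_all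
    finally have "1 + real A * (1 - real C / (real C + real d)) \<le> 1 + real A * (ln (real N) / (- ln ?t))"
      by (intro add_left_mono mult_left_mono) simp_all
    with 1 have "1 + real A * (1 - real C / (real C + real d)) \<le> ln ?s / ln ?t" by linarith
    then have "ereal (1 + real A * (1 - real C / (real C + real d))) \<le> ext_ln ?s / ext_ln ?t"
      using t1 s0 by (simp add: ext_ln_def)
    also have "\<dots> \<le> ?\<rho>"
      unfolding density_domination_exponent_def using W t1 by (intro Sup_upper) auto
    finally show ?thesis .
  qed
  have "(\<lambda>d. real C / (real C + real d)) \<longlonglongrightarrow> 0"
    by (intro real_tendsto_divide_at_top[OF tendsto_const] filterlim_tendsto_add_at_top[OF tendsto_const] filterlim_real_sequentially)
  then have "(\<lambda>d. 1 + real A * (1 - real C / (real C + real d))) \<longlonglongrightarrow> 1 + real A * (1 - 0)"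
    by (intro tendsto_intros)
  then have "(\<lambda>d. ereal (1 + real A * (1 - real C / (real C + real d)))) \<longlonglongrightarrow> ereal (1 + real A)"
    by (simp add: tendsto_ereal)
  from LIMSEQ_le_const2[OF this, of ?\<rho>] bound show ?thesis
    unfolding A_def by blast
qed

theorem theorem5p7:
  fixes n :: nat and a :: "nat \<Rightarrow> nat"
  assumes "n \<ge> 2"
  shows "density_domination_exponent (complete_graph n) (K' n a) = ereal (1 + real (\<Sum>i=1..n. a i))"
  using density_domination_exponent_K'_le[OF assms] density_domination_exponent_K'_ge[OF assms] by (rule antisym)

end
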